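(* Let $\mathbf{A}=(\mathcal{P},\mathcal{L},\parallel)$ and $\mathbf{A}'=(\mathcal{P}',\mathcal{L}',\parallel')$ be affine spaces with $\dim\mathbf{A}'\ge 3$, and let $\varphi:\mathcal{L}\to\mathcal{L}'$ be a bijection satisfying $a\sim b\implies a^\varphi\sim' b^\varphi$ for all $a,b\in\mathcal{L}$. Let $\lambda:\mathcal{P}\to\mathcal{P}'$ be the (well-defined, injective) map $a\cap b\mapsto a^\varphi\cap b^\varphi$ for adjacent $a,b\in\mathcal{L}$. Then each of the following conditions is sufficient for $\lambda$ to be a collineation (equivalently, for $\lambda$ to be surjective): (1) $\mathbf{A}$ or $\mathbf{A}'$ is a finite affine space; (2) $\dim\mathbf{A}\le\dim\mathbf{A}'<\infty$; (3) the order of $\mathbf{A}$ is different from two and every monomorphism of a coordinatizing (skew) field $F$ of $\mathbf{A}$ into a coordinatizing (skew) field $F'$ of $\mathbf{A}'$ is surjective; (4) $\mathbf{A}$ and $\mathbf{A}'$ are both affine spaces of order two.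
   Context: An affine space $\mathbf{A}=(\mathcal{P},\mathcal{L},\parallel)$ has point set $\mathcal{P}$, line set $\mathcal{L}$ and parallelism $\parallel$; its order is the number of points on a line. Lines $a,b$ are related, $a\sim b$, if $a\cap b\ne\emptyset$; adjacent, $a\approx b$, if related and distinct; analogously $\sim'$ in $\mathbf{A}'$. Under the hypotheses, $\dim\mathbf{A}\ge 3$, so $\mathbf{A}$ and $\mathbf{A}'$ are Desarguesian and are coordinatized by (skew) fields $F$ and $F'$, respectively. A collineation $\mathcal{P}\to\mathcal{P}'$ is a bijection mapping collinear triples to collinear triples and non-collinear triples to non-collinear triples. *)

theory Defs
  imports "HOL-Algebra.Module" "HOL-Algebra.RingHom" "HOL-Library.Extended_Nat"
begin

definition collinear ::
  "'p set set \<Rightarrow> 'p \<Rightarrow> 'p \<Rightarrow> 'p \<Rightarrow> bool" where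
  "collinear L x y z \<longleftrightarrow> (\<exists>l\<in>L. x \<in> l \<and> y \<in> l \<and> z \<in> l)"

text \<open>Affine space in the sense of Lenz/Karzel: unique joining lines, every line
has at least two points, parallelism is an equivalence relation on the lines,
Euclid's parallel axiom, and the triangle (Tamaschke) axiom.\<close>

definition affine_space ::
  "'p set \<Rightarrow> 'p set set \<Rightarrow> ('p set \<Rightarrow> 'p set \<Rightarrow> bool) \<Rightarrow> bool" where
  "affine_space P L par \<longleftrightarrow>
     P \<noteq> {} \<and>
     (\<forall>l\<in>L. l \<subseteq> P \<and> (\<exists>p\<in>l. \<exists>q\<in>l. p \<noteq> q)) \<and>
     (\<forall>p\<in>P. \<forall>q\<in>P. p \<noteq> q \<longrightarrow> (\<exists>!l. l \<in> L \<and> p \<in> l \<and> q \<in> l)) \<and>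
     (\<forall>l m. par l m \<longrightarrow> l \<in> L \<and> m \<in> L) \<and>
     (\<forall>l\<in>L. par l l) \<and>
     (\<forall>l m. par l m \<longrightarrow> par m l) \<and>
     (\<forall>l m n. par l m \<longrightarrow> par m n \<longrightarrow> par l n) \<and>
     (\<forall>p\<in>P. \<forall>l\<in>L. \<exists>!m. m \<in> L \<and> p \<in> m \<and> par m l) \<and>
     (\<forall>a\<in>P. \<forall>b\<in>P. \<forall>c\<in>P. \<forall>a'\<in>P. \<forall>b'\<in>P.
        \<not> collinear L a b c \<longrightarrow> a' \<noteq> b' \<longrightarrow>
        (\<forall>l\<in>L. \<forall>l'\<in>L. a \<in> l \<and> b \<in> l \<and> a' \<in> l' \<and> b' \<in> l' \<longrightarrow> par l l') \<longrightarrow>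
        (\<forall>m\<in>L. \<forall>n\<in>L. \<forall>k1\<in>L. \<forall>k2\<in>L.
           a \<in> k1 \<and> c \<in> k1 \<and> b \<in> k2 \<and> c \<in> k2 \<and>
           a' \<in> m \<and> par m k1 \<and> b' \<in> n \<and> par n k2 \<longrightarrow> m \<inter> n \<noteq> {}))"

definition subspace ::
  "'p set \<Rightarrow> 'p set set \<Rightarrow> ('p set \<Rightarrow> 'p set \<Rightarrow> bool) \<Rightarrow> 'p set \<Rightarrow> bool" where
  "subspace P L par S \<longleftrightarrow> S \<subseteq> P \<and>
     (\<forall>p\<in>S. \<forall>q\<in>S. p \<noteq> q \<longrightarrow> (\<forall>l\<in>L. p \<in> l \<and> q \<in> l \<longrightarrow> l \<subseteq> S)) \<and>
     (\<forall>p\<in>S. \<forall>l\<in>L. l \<subseteq> S \<longrightarrow> (\<forall>m\<in>L. p \<in> m \<and> par m l \<longrightarrow> m \<subseteq> S))"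

definition span ::
  "'p set \<Rightarrow> 'p set set \<Rightarrow> ('p set \<Rightarrow> 'p set \<Rightarrow> bool) \<Rightarrow> 'p set \<Rightarrow> 'p set" where
  "span P L par X = \<Inter>{S. subspace P L par S \<and> X \<subseteq> S}"

definition independent ::
  "'p set \<Rightarrow> 'p set set \<Rightarrow> ('p set \<Rightarrow> 'p set \<Rightarrow> bool) \<Rightarrow> 'p set \<Rightarrow> bool" where
  "independent P L par X \<longleftrightarrow> X \<subseteq> P \<and> (\<forall>x\<in>X. x \<notin> span P L par (X - {x}))"

definition affdim ::
  "'p set \<Rightarrow> 'p set set \<Rightarrow> ('p set \<Rightarrow> 'p set \<Rightarrow> bool) \<Rightarrow> enat" where
  "affdim P L par =
     (SUP X\<in>{X. finite X \<and> independent P L par X}. enat (card X)) - 1"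

definition has_order :: "'p set set \<Rightarrow> nat \<Rightarrow> bool" where
  "has_order L k \<longleftrightarrow> L \<noteq> {} \<and> (\<forall>l\<in>L. finite l \<and> card l = k)"

definition skew_field :: "('f, 'm) ring_scheme \<Rightarrow> bool" where
  "skew_field F \<longleftrightarrow> ring F \<and> \<one>\<^bsub>F\<^esub> \<noteq> \<zero>\<^bsub>F\<^esub> \<and>
     Units F = carrier F - {\<zero>\<^bsub>F\<^esub>}"

text \<open>Left vector space over a skew field (module axioms without commutativity).\<close>

definition left_vector_space :: "'f ring \<Rightarrow> ('f, 'v) module \<Rightarrow> bool" where
  "left_vector_space F V \<longleftrightarrow> skew_field F \<and> abelian_group V \<and> module_axioms F V"

definition affine_line :: "'f ring \<Rightarrow> ('f, 'v) module \<Rightarrow> 'v \<Rightarrow> 'v \<Rightarrow> 'v set" where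
  "affine_line F V a d = {a \<oplus>\<^bsub>V\<^esub> (t \<odot>\<^bsub>V\<^esub> d) | t. t \<in> carrier F}"

definition coordinatizes ::
  "'f ring \<Rightarrow> 'p set \<Rightarrow> 'p set set \<Rightarrow> ('p set \<Rightarrow> 'p set \<Rightarrow> bool) \<Rightarrow> bool" where
  "coordinatizes F P L par \<longleftrightarrow>
     (\<exists>V :: ('f, 'p) module. left_vector_space F V \<and> carrier V = P \<and>
        L = {affine_line F V a d | a d. a \<in> P \<and> d \<in> P \<and> d \<noteq> \<zero>\<^bsub>V\<^esub>} \<and>
        (\<forall>l m. par l m \<longleftrightarrow>
           (\<exists>a\<in>P. \<exists>b\<in>P. \<exists>d\<in>P. d \<noteq> \<zero>\<^bsub>V\<^esub> \<and>
              l = affine_line F V a d \<and> m = affine_line F V b d)))"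

definition collineation ::
  "'p set \<Rightarrow> 'p set set \<Rightarrow> 'q set \<Rightarrow> 'q set set \<Rightarrow> ('p \<Rightarrow> 'q) \<Rightarrow> bool" where
  "collineation P L P' L' f \<longleftrightarrow> bij_betw f P P' \<and>
     (\<forall>x\<in>P. \<forall>y\<in>P. \<forall>z\<in>P. collinear L x y z \<longleftrightarrow> collinear L' (f x) (f y) (f z))"

end

theory Submission
  imports Defs
begin

text \<open>
  Every line of \<open>A'\<close> is some \<open>phi l\<close> and meets the image of \<open>lam\<close> exactly in \<open>lam ` l\<close>, so \<open>lam\<close> is an
  embedding of \<open>A\<close> onto a subset of \<open>P'\<close> that spans \<open>P'\<close>, and only surjectivity is at stake.

  If \<open>P\<close> is finite and \<open>q\<close> is not in the image, then the \<open>r\<close> lines through \<open>q\<close> pull back to a partition of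
  \<open>P\<close> into lines of size \<open>k\<close>.  Hence \<open>P\<close> has \<open>r k\<close> points; counting along the lines through a point gives
  \<open>1 + r (k - 1)\<close>, so \<open>r = 1\<close>, which is absurd.

  If lines have at least three points, then parallel lines have parallel images.  First, their images
  are coplanar.  If two of them met in a point \<open>q\<close>, then, comparing with a parallel line whose image
  leaves their plane, all images of that parallel class would pass through \<open>q\<close>, and they would be all
  the lines through \<open>q\<close>.  A second parallel class is then mapped either into one parallel class, and
  the member of that class through \<open>q\<close> gives a contradiction, or onto the pencil of another point \<open>r\<close>,
  and the line \<open>q r\<close> does.

  For finite dimensions with \<open>dim A \<le> dim A'\<close>, two skew lines whose images meet would extend to a basis
  of \<open>A\<close> whose image spans \<open>A'\<close> with one point to spare.  For coordinatized spaces, preservation of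
  parallelism makes \<open>lam\<close> semiaffine, and its companion monomorphism is onto by hypothesis.
\<close>

section \<open>Affine spaces\<close>

lemma enat_diff_one_mono: "x \<le> y \<Longrightarrow> x - 1 \<le> y - (1::enat)"
  by (cases x; cases y) (auto simp: one_enat_def)

locale aff_space =
  fixes P :: "'p set" and L :: "'p set set" and par :: "'p set \<Rightarrow> 'p set \<Rightarrow> bool"
  assumes affine: "affine_space P L par"
begin

lemma affine_space_axioms:
  shows ax_line: "\<forall>l\<in>L. l \<subseteq> P \<and> (\<exists>p\<in>l. \<exists>q\<in>l. p \<noteq> q)"
    and ax_join: "\<forall>p\<in>P. \<forall>q\<in>P. p \<noteq> q \<longrightarrow> (\<exists>!l. l \<in> L \<and> p \<in> l \<and> q \<in> l)"
    and ax_par_line: "\<forall>l m. par l m \<longrightarrow> l \<in> L \<and> m \<in> L"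
    and ax_par_refl: "\<forall>l\<in>L. par l l"
    and ax_par_sym: "\<forall>l m. par l m \<longrightarrow> par m l"
    and ax_par_trans: "\<forall>l m n. par l m \<longrightarrow> par m n \<longrightarrow> par l n"
    and ax_parallel: "\<forall>p\<in>P. \<forall>l\<in>L. \<exists>!m. m \<in> L \<and> p \<in> m \<and> par m l"
  using affine unfolding affine_space_def by - (elim conjE, assumption)+

lemma line_subset: "l \<in> L \<Longrightarrow> l \<subseteq> P"
  using ax_line by blast

lemma line_two_points:
  assumes "l \<in> L" obtains p q where "p \<in> l" "q \<in> l" "p \<noteq> q"
  using ax_line assms by blast

lemma line_other_point:
  assumes "l \<in> L" obtains q where "q \<in> l" "q \<noteq> p"
  using line_two_points[OF assms] by metis

lemma join_ex:
  assumes "p \<in> P" "q \<in> P" "p \<noteq> q"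
  obtains l where "l \<in> L" "p \<in> l" "q \<in> l"
  using ax_join assms by blast

lemma join_unique:
  assumes "p \<noteq> q" "l \<in> L" "p \<in> l" "q \<in> l" "m \<in> L" "p \<in> m" "q \<in> m"
  shows "l = m"
proof -
  have "p \<in> P" "q \<in> P"
    using assms line_subset by blast+
  then have "\<exists>!l. l \<in> L \<and> p \<in> l \<and> q \<in> l"
    using ax_join assms(1) by blast
  then show ?thesis
    using assms by blast
qed

lemma par_line: "par l m \<Longrightarrow> l \<in> L" "par l m \<Longrightarrow> m \<in> L"
  using ax_par_line by blast+

lemma par_refl: "l \<in> L \<Longrightarrow> par l l"
  using ax_par_refl by blast

lemma par_sym: "par l m \<Longrightarrow> par m l"
  using ax_par_sym by blast

lemma par_trans: "par l m \<Longrightarrow> par m n \<Longrightarrow> par l n"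
  using ax_par_trans by blast

lemma parallel_ex1:
  assumes "p \<in> P" "l \<in> L"
  shows "\<exists>!m. m \<in> L \<and> p \<in> m \<and> par m l"
  using ax_parallel assms by blast

lemma parallel_ex:
  assumes "p \<in> P" "l \<in> L"
  obtains m where "p \<in> m" "par m l" "m \<in> L"
  using parallel_ex1[OF assms] by blast

lemma parallel_unique:
  assumes "par l m" "p \<in> l" "p \<in> m"
  shows "l = m"
proof -
  have "\<exists>!n. n \<in> L \<and> p \<in> n \<and> par n m"
    using parallel_ex1[of p m] assms par_line[OF assms(1)] line_subset by blast
  then show ?thesis
    using assms par_line[OF assms(1)] par_refl by blast
qed

section \<open>Incidence consequences of the triangle axiom\<close>

lemma triangle:
  assumes "a \<noteq> b" "a' \<noteq> b'" "a \<in> l" "b \<in> l" "c \<notin> l" "a' \<in> l'" "b' \<in> l'" "par l l'"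
    and k1: "k1 \<in> L" "a \<in> k1" "c \<in> k1" and k2: "k2 \<in> L" "b \<in> k2" "c \<in> k2"
    and m: "a' \<in> m" "par m k1" and n: "b' \<in> n" "par n k2"
  obtains x where "x \<in> m" "x \<in> n"
proof -
  have l: "l \<in> L" "l' \<in> L"
    using par_line assms by blast+
  have pts: "a \<in> P" "b \<in> P" "c \<in> P" "a' \<in> P" "b' \<in> P"
    using line_subset assms l by blast+
  have nc: "\<not> collinear L a b c"
    unfolding collinear_def using assms l join_unique by metis
  \<comment> \<open>The axiom speaks of all lines joining the two pairs of points; uniqueness of
    joining lines reduces this to the given \<open>l\<close> and \<open>l'\<close>.\<close>
  have pp: "\<forall>h\<in>L. \<forall>h'\<in>L. a \<in> h \<and> b \<in> h \<and> a' \<in> h' \<and> b' \<in> h' \<longrightarrow> par h h'"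
    using assms l join_unique by metis
  have "\<forall>a\<in>P. \<forall>b\<in>P. \<forall>c\<in>P. \<forall>a'\<in>P. \<forall>b'\<in>P.
        \<not> collinear L a b c \<longrightarrow> a' \<noteq> b' \<longrightarrow>
        (\<forall>l\<in>L. \<forall>l'\<in>L. a \<in> l \<and> b \<in> l \<and> a' \<in> l' \<and> b' \<in> l' \<longrightarrow> par l l') \<longrightarrow>
        (\<forall>m\<in>L. \<forall>n\<in>L. \<forall>k1\<in>L. \<forall>k2\<in>L.
           a \<in> k1 \<and> c \<in> k1 \<and> b \<in> k2 \<and> c \<in> k2 \<and>
           a' \<in> m \<and> par m k1 \<and> b' \<in> n \<and> par n k2 \<longrightarrow> m \<inter> n \<noteq> {})"
    using affine unfolding affine_space_def by (elim conjE) assumption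
  from this[rule_format, OF pts nc \<open>a' \<noteq> b'\<close> pp[rule_format] _ _ k1(1) k2(1)] m n k1 k2 par_line
  have "m \<inter> n \<noteq> {}"
    by blast
  then show ?thesis
    using that by blast
qed

text \<open>Apply the triangle axiom to the triangle \<open>s\<close>, \<open>z\<close>,
  \<open>y\<close>, with the side \<open>s z\<close> sent to itself reversed; the new third vertex
  is the fourth corner of a parallelogram. Coinciding points are settled directly or by uniqueness
  of parallels.\<close>

lemma parallelogram:
  assumes gg: "par g g'" and k: "k \<in> L" "s \<in> k" "s \<in> g" "y \<in> k" "y \<in> g'" "\<not> par k g"
    and h: "par h k" "z \<in> h" "z \<in> g'"
  obtains x where "x \<in> h" "x \<in> g"
proof (cases "z = y \<or> y = s \<or> z = s")
  case True
  then show ?thesis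
    using that assms parallel_unique by metis
next
  case False
  have L: "g \<in> L" "g' \<in> L" "h \<in> L"
    using gg h par_line by blast+
  obtain l where l: "l \<in> L" "s \<in> l" "z \<in> l"
    using join_ex[of s z] False k h L line_subset by blast
  have "y \<notin> l"
  proof
    assume "y \<in> l"
    then have "l = k" "l = g'"
      using join_unique[of y s l k] join_unique[of y z l g'] l k h L False by auto
    then show False
      using k gg par_sym by blast
  qed
  then show ?thesis
    using triangle[of s z z s l y l k g' h g] that l k h gg L False par_refl by metis
qed

text \<open>Veblen-Young property in affine form, standing in for coplanarity of \<open>a\<close>
  and \<open>b\<close>. The parallel \<open>c\<close> to \<open>a\<close> through \<open>r1\<close>
  cuts \<open>k2\<close> in some \<open>s\<close>, and the triangle \<open>s\<close>,
  \<open>r2\<close>, \<open>r1\<close> is carried to the base \<open>p2\<close>, \<open>r2\<close>,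
  where its third vertex lies on both \<open>a\<close> and \<open>b\<close>.\<close>

lemma veblen:
  assumes k: "k1 \<in> L" "k2 \<in> L" "k1 \<noteq> k2" "w \<in> k1" "w \<in> k2"
    and a: "a \<in> L" "p1 \<in> a" "p2 \<in> a" "p1 \<in> k1" "p2 \<in> k2" "p1 \<noteq> w" "p2 \<noteq> w"
    and b: "b \<in> L" "r1 \<in> b" "r2 \<in> b" "r1 \<in> k1" "r2 \<in> k2" "r1 \<noteq> w" "r2 \<noteq> w"
  shows "par a b \<or> (\<exists>q. q \<in> a \<and> q \<in> b)"
proof (cases "par a b \<or> p1 = r1 \<or> p2 = r2")
  case True
  then show ?thesis
    using a b by blast
next
  case False
  obtain c where c: "r1 \<in> c" "par c a" "c \<in> L"
    using parallel_ex[of r1 a] a b line_subset by blast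
  have p2k1: "p2 \<notin> k1"
    using k a join_unique by metis
  have r1k2: "r1 \<notin> k2"
    using k b join_unique by metis
  obtain s where s: "s \<in> c" "s \<in> k2"
    using triangle[of p1 w r1 w k1 p2 k1 a k2 c k2] k a b c p2k1 par_refl by metis
  have sr: "s \<noteq> r2"
    using False join_unique[of r1 r2 b c] b c s r1k2 k par_sym by metis
  show ?thesis
    using triangle[of s r2 p2 r2 k2 r1 k2 c b a b] False sr s k a b c r1k2 par_refl par_sym by metis
qed

section \<open>Comparing lines by parallel projection\<close>

lemma lines_embed_meeting:
  assumes l: "l \<in> L" "p \<in> l" and m: "m \<in> L" "p \<in> m"
  shows "\<exists>f. inj_on f l \<and> f ` l \<subseteq> m"
proof (cases "l = m")
  case True
  then show ?thesis
    by (intro exI[of _ id]) auto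
next
  case False
  obtain a where a: "a \<in> l" "a \<noteq> p"
    using line_other_point l by blast
  obtain b where b: "b \<in> m" "b \<noteq> p"
    using line_other_point m by blast
  have al: "a \<notin> m" "b \<notin> l"
    using False a b l m join_unique by metis+
  obtain d where d: "d \<in> L" "a \<in> d" "b \<in> d"
    using join_ex[of a b] a b l m al line_subset by blast
  \<comment> \<open>Projection of \<open>l\<close> to \<open>m\<close> along the parallels of
    \<open>d\<close>; the triangle axiom makes each such parallel meet \<open>m\<close>.\<close>
  have ex: "\<exists>y n. y \<in> m \<and> x \<in> n \<and> y \<in> n \<and> par n d" if x: "x \<in> l" for x
  proof -
    obtain n where n: "x \<in> n" "par n d" "n \<in> L"
      using parallel_ex[of x d] x l d line_subset by blast
    show ?thesis
    proof (cases "x = p")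
      case True
      then show ?thesis using n m by blast
    next
      case False
      then show ?thesis
        using triangle[of p a p x l b l m d m n] n m l a b d x al par_refl by metis
    qed
  qed
  then obtain f where f: "\<And>x. x \<in> l \<Longrightarrow> f x \<in> m \<and> (\<exists>n. x \<in> n \<and> f x \<in> n \<and> par n d)"
    by metis
  have "x = y" if xy: "x \<in> l" "y \<in> l" "f x = f y" for x y
  proof (rule ccontr)
    assume ne: "x \<noteq> y"
    obtain n where n: "x \<in> n" "f x \<in> n" "par n d"
      using f xy by blast
    obtain n' where n': "y \<in> n'" "f y \<in> n'" "par n' d"
      using f xy by blast
    have "n = n'"
      using n n' xy parallel_unique par_sym par_trans by metis
    \<comment> \<open>Two points with the same image lie on one projecting line, which is then
      \<open>l\<close> itself; as it shares \<open>a\<close> with its parallel \<open>d\<close>,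
      this gives \<open>l = d\<close>, although \<open>b\<close> is off \<open>l\<close>.\<close>
    then have "n = l"
      using join_unique[OF ne] n n' xy l par_line by metis
    then have "l = d"
      using n a d parallel_unique by metis
    then show False
      using al d by blast
  qed
  then show ?thesis
    using f by (intro exI[of _ f]) (auto simp: inj_on_def)
qed

text \<open>Disjoint lines are compared through a line joining a point of \<open>l\<close> to a
  different point of \<open>m\<close>.\<close>

lemma lines_embed:
  assumes l: "l \<in> L" and m: "m \<in> L"
  obtains f where "inj_on f l" "f ` l \<subseteq> m"
proof -
  obtain x where x: "x \<in> l" using line_two_points l by metis
  obtain y where y: "y \<in> m" "y \<noteq> x" using line_other_point m by metis
  obtain n where n: "n \<in> L" "x \<in> n" "y \<in> n"
    using join_ex[of x y] x y l m line_subset by blast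
  obtain f where f: "inj_on f l" "f ` l \<subseteq> n"
    using lines_embed_meeting[OF l x n(1,2)] by blast
  obtain g where g: "inj_on g n" "g ` n \<subseteq> m"
    using lines_embed_meeting[OF n(1,3) m y(1)] by blast
  show ?thesis
    using that[of "g \<circ> f"] f g comp_inj_on[of f l g] inj_on_subset[of g n "f ` l"] by auto
qed

lemma lines_equal_card:
  assumes "finite P" "l \<in> L" "m \<in> L"
  shows "card l = card m"
proof -
  have fin: "finite l" "finite m"
    using assms line_subset finite_subset by metis+
  obtain f where "inj_on f l" "f ` l \<subseteq> m" using lines_embed assms by blast
  moreover obtain g where "inj_on g m" "g ` m \<subseteq> l" using lines_embed assms by blast
  ultimately show ?thesis
    using card_inj_on_le fin le_antisym by metis
qed

text \<open>If \<open>x\<close> and \<open>y\<close> exhausted \<open>l\<close>, every line would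
  embed into \<open>l\<close> and so have exactly two points.\<close>

lemma third_point:
  assumes "\<not> has_order L 2" "l \<in> L"
  obtains z where "z \<in> l" "z \<noteq> x" "z \<noteq> y"
proof (rule ccontr)
  assume "\<not> thesis"
  then have sub: "l \<subseteq> {x, y}"
    using that by blast
  have "finite m \<and> card m = 2" if m: "m \<in> L" for m
  proof -
    obtain f where f: "inj_on f m" "f ` m \<subseteq> l" using lines_embed m assms by blast
    have fl: "finite l" using sub finite_subset by blast
    have "card l \<le> 2"
      using sub card_mono[of "{x,y}" l] by (auto simp: card_insert_if split: if_splits)
    then have le: "card m \<le> 2" "finite m"
      using card_inj_on_le[OF f fl] inj_on_finite[OF f fl] by auto
    obtain p q where "p \<in> m" "q \<in> m" "p \<noteq> q" using line_two_points m by blast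
    then have "card {p, q} \<le> card m"
      using le by (intro card_mono) auto
    then show ?thesis
      using le \<open>p \<noteq> q\<close> by simp
  qed
  then show False
    using assms unfolding has_order_def by blast
qed

subsection \<open>Subspaces and dimension\<close>

lemma subspaceI:
  assumes "S \<subseteq> P"
    and "\<And>p q l z. p \<in> S \<Longrightarrow> q \<in> S \<Longrightarrow> p \<noteq> q \<Longrightarrow> l \<in> L \<Longrightarrow> p \<in> l \<Longrightarrow> q \<in> l \<Longrightarrow> z \<in> l \<Longrightarrow> z \<in> S"
    and "\<And>p l m z. p \<in> S \<Longrightarrow> l \<subseteq> S \<Longrightarrow> par m l \<Longrightarrow> p \<in> m \<Longrightarrow> z \<in> m \<Longrightarrow> z \<in> S"
  shows "subspace P L par S"
  using assms unfolding subspace_def by blast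

lemma subspace_line:
  assumes "subspace P L par S" "p \<in> S" "q \<in> S" "p \<noteq> q" "l \<in> L" "p \<in> l" "q \<in> l"
  shows "l \<subseteq> S"
  using assms unfolding subspace_def by blast

lemma subspace_parallel:
  assumes "subspace P L par S" "p \<in> S" "l \<subseteq> S" "par m l" "p \<in> m"
  shows "m \<subseteq> S"
  using assms par_line[OF assms(4)] unfolding subspace_def by blast

lemma subspace_subset: "subspace P L par S \<Longrightarrow> S \<subseteq> P"
  by (simp add: subspace_def)

lemma subspace_empty: "subspace P L par {}"
  by (simp add: subspace_def)

lemma subspace_UNIV: "subspace P L par P"
  by (simp add: subspace_def line_subset)

lemma subspace_singleton: "x \<in> P \<Longrightarrow> subspace P L par {x}"
proof (rule subspaceI)
  fix p l m z assume "l \<subseteq> {x}" "par m l"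
  then show "z \<in> {x}"
    using line_two_points[OF par_line(2)[OF \<open>par m l\<close>]] by (metis subsetD singletonD)
qed auto

lemma line_is_subspace:
  assumes "l \<in> L" shows "subspace P L par l"
proof (rule subspaceI)
  fix p k m z assume "p \<in> l" "k \<subseteq> l" "par m k" "p \<in> m" "z \<in> m"
  moreover from this have "k = l"
    using line_two_points[of k] join_unique assms par_line by (metis subsetD)
  ultimately show "z \<in> l"
    using parallel_unique by blast
qed (use line_subset[OF assms] join_unique[of _ _ _ l] assms in blast)+

lemma span_least: "subspace P L par S \<Longrightarrow> X \<subseteq> S \<Longrightarrow> span P L par X \<subseteq> S"
  unfolding span_def by blast

lemma span_superset: "X \<subseteq> span P L par X"
  unfolding span_def by blast

lemma subspace_span:
  assumes "X \<subseteq> P" shows "subspace P L par (span P L par X)"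
proof (rule subspaceI)
  show "span P L par X \<subseteq> P"
    using span_least[OF subspace_UNIV assms] .
next
  fix p q l z assume h: "p \<in> span P L par X" "q \<in> span P L par X" "p \<noteq> q" "l \<in> L"
    "p \<in> l" "q \<in> l" "z \<in> l"
  show "z \<in> span P L par X"
    unfolding span_def
  proof (rule InterI)
    fix S assume "S \<in> {S. subspace P L par S \<and> X \<subseteq> S}"
    then have S: "subspace P L par S" "p \<in> S" "q \<in> S"
      using h unfolding span_def by blast+
    show "z \<in> S"
      using subspace_line[OF S h(3-6)] h by blast
  qed
next
  fix p l m z assume h: "p \<in> span P L par X" "l \<subseteq> span P L par X" "par m l" "p \<in> m" "z \<in> m"
  show "z \<in> span P L par X"
    unfolding span_def
  proof (rule InterI)
    fix S assume "S \<in> {S. subspace P L par S \<and> X \<subseteq> S}"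
    then have S: "subspace P L par S" "p \<in> S" "l \<subseteq> S"
      using h unfolding span_def by blast+
    show "z \<in> S"
      using subspace_parallel[OF S h(3,4)] h by blast
  qed
qed

lemma span_mono: "X \<subseteq> Y \<Longrightarrow> span P L par X \<subseteq> span P L par Y"
  unfolding span_def by blast

text \<open>That this is again a subspace yields the exchange property of the affine span.\<close>

definition cylinder :: "'p set \<Rightarrow> 'p set \<Rightarrow> 'p set" where
  "cylinder d S = {y. \<exists>k s. par k d \<and> y \<in> k \<and> s \<in> k \<and> s \<in> S}"

lemma cylinderI: "par k d \<Longrightarrow> y \<in> k \<Longrightarrow> s \<in> k \<Longrightarrow> s \<in> S \<Longrightarrow> y \<in> cylinder d S"
  unfolding cylinder_def by blast

lemma cylinder_superset:
  assumes "d \<in> L" "S \<subseteq> P" shows "S \<subseteq> cylinder d S"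
proof
  fix s assume "s \<in> S"
  moreover from this obtain k where "s \<in> k" "par k d"
    using parallel_ex assms by blast
  ultimately show "s \<in> cylinder d S"
    using cylinderI by blast
qed

text \<open>Projection along \<open>d\<close> sends \<open>y1\<close>, \<open>y2\<close>,
  \<open>p\<close> to \<open>s1\<close>, \<open>s2\<close>, \<open>s3\<close> in \<open>S\<close>,
  and should send \<open>m\<close> to the parallel \<open>h\<close> of the line \<open>g\<close>
  through \<open>s1\<close> and \<open>s2\<close>. So the parallel \<open>e\<close> to
  \<open>d\<close> through \<open>z\<close> has to meet \<open>h\<close>, which lies in
  \<open>S\<close>.\<close>

lemma cylinder_project:
  assumes S: "subspace P L par S" and d: "d \<in> L"
    and y: "y1 \<noteq> y2" "y1 \<in> cylinder d S" "y2 \<in> cylinder d S"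
    and l: "l \<in> L" "y1 \<in> l" "y2 \<in> l" "\<not> par l d"
    and m: "par m l" "p \<in> m" "z \<in> m" and p: "p \<in> cylinder d S"
  shows "z \<in> cylinder d S"
proof (cases "z = p")
  case True
  then show ?thesis using p by simp
next
  case zp: False
  obtain k1 s1 where 1: "par k1 d" "y1 \<in> k1" "s1 \<in> k1" "s1 \<in> S"
    using y unfolding cylinder_def by blast
  obtain k2 s2 where 2: "par k2 d" "y2 \<in> k2" "s2 \<in> k2" "s2 \<in> S"
    using y unfolding cylinder_def by blast
  obtain k3 s3 where 3: "par k3 d" "p \<in> k3" "s3 \<in> k3" "s3 \<in> S"
    using p unfolding cylinder_def by blast
  have k: "k1 \<in> L" "k2 \<in> L" "k3 \<in> L" "m \<in> L" "par k1 k2" "par k3 k2"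
    using 1 2 3 m par_line par_sym par_trans by blast+
  have k12: "k1 \<noteq> k2"
    using join_unique[OF y(1)] 1 2 l k by metis
  then have s12: "s1 \<noteq> s2"
    using 1 2 k parallel_unique by metis
  obtain g where g: "g \<in> L" "s1 \<in> g" "s2 \<in> g"
    using join_ex[OF _ _ s12] 1 2 k line_subset by blast
  have gS: "g \<subseteq> S"
    using subspace_line[OF S 1(4) 2(4) s12 g] .
  have gd: "\<not> par g d"
  proof
    assume "par g d"
    then have "g = k1" "g = k2"
      using g 1 2 parallel_unique par_sym par_trans by metis+
    then show False using k12 by simp
  qed
  obtain h where h: "s3 \<in> h" "par h g" "h \<in> L"
    using parallel_ex[of s3 g] 3 g k line_subset by blast
  have hS: "h \<subseteq> S"
    using subspace_parallel[OF S 3(4) gS h(2,1)] .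
  obtain e where e: "z \<in> e" "par e d" "e \<in> L"
    using parallel_ex[of z d] d m k line_subset by blast
  have ek: "par e k3" "par e k2"
    using e 2 3 par_sym par_trans by blast+
  have k3h: "\<not> par k3 h" and lk: "\<not> par k2 l"
    using gd 2 3 h l par_sym par_trans by meson+
  \<comment> \<open>The meeting is first shown with the parallel \<open>h'\<close> to
    \<open>g\<close> through \<open>p\<close>, where \<open>p z\<close> can serve as the base of a
    triangle, and then moved along \<open>k3\<close> to \<open>h\<close> by a parallelogram.\<close>
  obtain h' where h': "p \<in> h'" "par h' g" "h' \<in> L"
    using parallel_ex[of p g] m g k line_subset by blast
  have hh: "par h h'"
    using h h' par_sym par_trans by blast
  have "\<exists>w. w \<in> e \<and> w \<in> h'"
  proof (cases "par l g")
    case True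
    then have "m = h'"
      using m h' parallel_unique par_sym par_trans by metis
    then show ?thesis
      using m e by blast
  next
    case False
    \<comment> \<open>\<open>g'\<close> is \<open>g\<close> shifted to \<open>y1\<close>. It cuts
      \<open>k2\<close> in \<open>t\<close>, and the triangle \<open>y1\<close>, \<open>y2\<close>,
      \<open>t\<close> is transported to the base \<open>p\<close>, \<open>z\<close>.\<close>
    obtain g' where g': "y1 \<in> g'" "par g' g" "g' \<in> L"
      using parallel_ex[of y1 g] l g line_subset by blast
    have "\<not> par k1 g'"
      using gd 1 g' par_sym par_trans by meson
    then obtain t where t: "t \<in> k2" "t \<in> g'"
      using parallelogram[of g' g k1 y1 s1 k2 s2] g' g 1 2 k par_sym by metis
    have "t \<noteq> y2"
      using False join_unique[OF y(1)] t l g' by metis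
    moreover have "t \<notin> l"
      using calculation join_unique[of t y2 l k2] t 2 l k lk par_refl by metis
    moreover have "par l m" "par h' g'"
      using m h' g' par_sym par_trans by blast+
    ultimately show ?thesis
      using triangle[of y1 y2 p z l t m g' k2 h' e] y(1) zp l g' t k 2 h' e ek m par_sym by metis
  qed
  then obtain w where w: "w \<in> e" "w \<in> h'" by blast
  obtain s where "s \<in> e" "s \<in> h"
    using parallelogram[OF hh k(3) 3(3) h(1) 3(2) h'(1) k3h ek(1) w] by blast
  then show ?thesis
    using cylinderI e hS by blast
qed

text \<open>Lines parallel to \<open>d\<close> stay inside by uniqueness of parallels. For all
  others \<open>cylinder_project\<close> serves both clauses, with \<open>m = l\<close> for joining
  lines.\<close>

lemma cylinder_subspace:
  assumes S: "subspace P L par S" and d: "d \<in> L"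
  shows "subspace P L par (cylinder d S)"
proof (rule subspaceI)
  show "cylinder d S \<subseteq> P"
    unfolding cylinder_def using par_line line_subset by blast
next
  fix y1 y2 l z assume h: "y1 \<in> cylinder d S" "y2 \<in> cylinder d S" "y1 \<noteq> y2" "l \<in> L"
    "y1 \<in> l" "y2 \<in> l" "z \<in> l"
  show "z \<in> cylinder d S"
  proof (cases "par l d")
    case True
    obtain k s where k: "par k d" "y1 \<in> k" "s \<in> k" "s \<in> S"
      using h unfolding cylinder_def by blast
    then have "k = l"
      using True h parallel_unique par_sym par_trans by metis
    then show ?thesis
      using k h cylinderI by metis
  next
    case False
    then show ?thesis
      using cylinder_project[OF S d h(3,1,2,4,5,6) False par_refl[OF h(4)] h(5,7,1)] by blast
  qed
next
  fix p l m z assume h: "p \<in> cylinder d S" "l \<subseteq> cylinder d S" "par m l" "p \<in> m" "z \<in> m"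
  have l: "l \<in> L" using h par_line by blast
  show "z \<in> cylinder d S"
  proof (cases "par l d")
    case True
    obtain k s where k: "par k d" "p \<in> k" "s \<in> k" "s \<in> S"
      using h unfolding cylinder_def by blast
    then have "k = m"
      using True h parallel_unique par_sym par_trans by metis
    then show ?thesis
      using k h cylinderI by metis
  next
    case False
    obtain y1 y2 where y: "y1 \<in> l" "y2 \<in> l" "y1 \<noteq> y2"
      using line_two_points[OF l] by metis
    show ?thesis
      using cylinder_project[OF S d y(3) _ _ l y(1,2) False h(3-5) h(1)] y h by blast
  qed
qed

lemma span_insert_subset_cylinder:
  assumes "subspace P L par S" "X \<subseteq> S" "s \<in> S" "d \<in> L" "s \<in> d" "x \<in> d"
  shows "span P L par (insert x X) \<subseteq> cylinder d S"
  using span_least[OF cylinder_subspace] cylinder_superset subspace_subset assms cylinderI par_refl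
  by (metis insert_subset subset_trans)

section \<open>Exchange, bases and dimension\<close>

lemma exchange:
  assumes X: "X \<subseteq> P" "x \<in> P" and y: "y \<in> span P L par (insert x X)" "y \<notin> span P L par X"
  shows "x \<in> span P L par (insert y X)"
proof (cases "X = {}")
  \<comment> \<open>A cylinder needs a base point, so the empty \<open>X\<close> is treated apart:
    the span of \<open>x\<close> is \<open>{x}\<close>.\<close>
  case True
  then have "y = x"
    using span_least[OF subspace_singleton[OF X(2)], of "{x}"] y by auto
  then show ?thesis using span_superset[of "insert y X"] by blast
next
  case False
  define S where "S = span P L par X"
  have S: "subspace P L par S" "X \<subseteq> S"
    unfolding S_def using subspace_span[of X] span_superset[of X] X by blast+
  obtain s where s: "s \<in> X" using False by blast
  have yP: "y \<in> P"
    using y(1) span_least[OF subspace_UNIV, of "insert x X"] X by blast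
  let ?T = "span P L par (insert y X)"
  have T: "subspace P L par ?T" "S \<subseteq> ?T" "y \<in> ?T"
    using subspace_span[of "insert y X"] span_superset[of "insert y X"]
      span_mono[OF subset_insertI] X yP unfolding S_def by simp_all
  show ?thesis
  proof (cases "x = s")
    case True
    then show ?thesis using s span_superset[of "insert y X"] by blast
  next
    case False
    obtain d where d: "d \<in> L" "s \<in> d" "x \<in> d"
      using join_ex[of s x] False X s by blast
    \<comment> \<open>\<open>y\<close> lies on a parallel \<open>k\<close> to \<open>d\<close> that
      starts in \<open>S\<close>. As \<open>y\<close> is outside \<open>S\<close>, two points put
      \<open>k\<close> into \<open>?T\<close>; then \<open>d\<close>, parallel to \<open>k\<close>
      through \<open>s\<close>, brings \<open>x\<close> into \<open>?T\<close>.\<close>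
    have "y \<in> cylinder d S"
      using span_insert_subset_cylinder[OF S _ d] s S y by blast
    then obtain k t where k: "par k d" "y \<in> k" "t \<in> k" "t \<in> S"
      unfolding cylinder_def by blast
    have "y \<noteq> t" using k y S_def by blast
    then have "k \<subseteq> ?T"
      using subspace_line[OF T(1), of y t k] T k par_line by blast
    then have "d \<subseteq> ?T"
      using subspace_parallel[OF T(1), of s k d] k d s S T par_sym by blast
    then show ?thesis using d by blast
  qed
qed

text \<open>If an old point \<open>x\<close> became dependent, exchange would put \<open>y\<close>
  into the span of \<open>I\<close>.\<close>

lemma independent_insert:
  assumes I: "independent P L par I" and y: "y \<in> P" "y \<notin> span P L par I"
  shows "independent P L par (insert y I)"
  unfolding independent_def
proof (intro conjI ballI)
  have IP: "I \<subseteq> P" and ind: "\<And>x. x \<in> I \<Longrightarrow> x \<notin> span P L par (I - {x})"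
    using I unfolding independent_def by blast+
  show "insert y I \<subseteq> P" using IP y by blast
  have yI: "y \<notin> I" using y span_superset[of I] by blast
  fix x assume x: "x \<in> insert y I"
  show "x \<notin> span P L par (insert y I - {x})"
  proof (cases "x = y")
    case True
    then show ?thesis using y yI by simp
  next
    case False
    then have xI: "x \<in> I" using x by blast
    have eq: "insert y I - {x} = insert y (I - {x})" "insert x (I - {x}) = I"
      using False xI by blast+
    show ?thesis
    proof
      assume "x \<in> span P L par (insert y I - {x})"
      then have "y \<in> span P L par (insert x (I - {x}))"
        unfolding eq(1) using exchange[of "I - {x}" y x] IP y ind[OF xI] by blast
      then show False using eq y by simp
    qed
  qed
qed

lemma independent_subset:
  assumes "independent P L par I" "J \<subseteq> I" shows "independent P L par J"
  using assms span_mono unfolding independent_def by (meson Diff_mono order_refl subset_eq)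

text \<open>Replace a point \<open>x\<close> of \<open>I\<close> outside \<open>J\<close> by a point
  of \<open>J\<close> outside the span of the rest of \<open>I\<close>; it exists, since otherwise
  that span would contain the span of \<open>J\<close> and thus \<open>x\<close>. Size and
  independence are kept, and fewer points remain outside \<open>J\<close>.\<close>

lemma steinitz:
  assumes "finite I" "finite J" "independent P L par I" "J \<subseteq> P" "I \<subseteq> span P L par J"
  shows "card I \<le> card J"
  using assms(1,3,5)
proof (induction "card (I - J)" arbitrary: I rule: less_induct)
  case less
  show ?case
  proof (cases "I \<subseteq> J")
    case True
    then show ?thesis using card_mono assms by blast
  next
    case False
    then obtain x where x: "x \<in> I" "x \<notin> J" by blast
    let ?K = "I - {x}"
    have xK: "x \<notin> span P L par ?K" and IP: "I \<subseteq> P"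
      using less x unfolding independent_def by blast+
    have "\<not> J \<subseteq> span P L par ?K"
    proof
      assume "J \<subseteq> span P L par ?K"
      then have "span P L par J \<subseteq> span P L par ?K"
        using span_least[OF subspace_span[of ?K]] IP by blast
      then show False using xK x less.prems(3) by blast
    qed
    then obtain y where y: "y \<in> J" "y \<notin> span P L par ?K" by blast
    have yK: "y \<notin> ?K" using y span_superset[of ?K] by blast
    have ind: "independent P L par (insert y ?K)"
      using independent_insert[OF independent_subset[OF less.prems(2)] _ y(2)] y assms(4) by blast
    have "insert y ?K - J \<subset> I - J" using x y(1) by auto
    then have "card (insert y ?K - J) < card (I - J)"
      using less.prems(1) psubset_card_mono[of "I - J"] by blast
    moreover have "insert y ?K \<subseteq> span P L par J"
      using y span_superset[of J] less.prems(3) by blast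
    ultimately have "card (insert y ?K) \<le> card J"
      using less.hyps[of "insert y ?K"] less.prems(1) ind by simp
    moreover have "card (insert y ?K) = card I"
      using yK card.remove[OF less.prems(1) x(1)] less.prems(1) by simp
    ultimately show ?thesis by simp
  qed
qed

lemma independent_card_le_affdim:
  assumes "finite X" "independent P L par X"
  shows "enat (card X) - 1 \<le> affdim P L par"
  unfolding affdim_def using assms
  by (intro enat_diff_one_mono SUP_upper) auto

lemma affdim_le:
  assumes "\<And>X. finite X \<Longrightarrow> independent P L par X \<Longrightarrow> card X \<le> Suc n"
  shows "affdim P L par \<le> enat n"
proof -
  have "(SUP X\<in>{X. finite X \<and> independent P L par X}. enat (card X)) \<le> enat (Suc n)"
    using assms by (intro SUP_least) auto
  then have "affdim P L par \<le> enat (Suc n) - 1"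
    unfolding affdim_def by (rule enat_diff_one_mono)
  then show ?thesis by (simp add: one_enat_def)
qed

text \<open>An independent set has at most one point more than the dimension, so a largest
  independent superset of \<open>I\<close> exists; by \<open>independent_insert\<close> it
  spans.\<close>

lemma extend_to_basis:
  assumes dim: "affdim P L par < \<infinity>" and I: "finite I" "independent P L par I"
  obtains B where "finite B" "independent P L par B" "I \<subseteq> B" "span P L par B = P"
proof -
  obtain n where n: "affdim P L par = enat n" using dim by auto
  let ?Q = "\<lambda>B. finite B \<and> independent P L par B \<and> I \<subseteq> B"
  have bound: "card B \<le> Suc n" if "?Q B" for B
    using independent_card_le_affdim[of B] that n by (simp add: one_enat_def)
  have "?Q I" using I by blast
  then obtain B where B: "?Q B" and max: "\<And>C. ?Q C \<Longrightarrow> card C \<le> card B"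
    using ex_has_greatest_nat[of ?Q I card "Suc (Suc n)"] bound less_Suc_eq_le by metis
  have BP: "B \<subseteq> P" using B unfolding independent_def by blast
  have "y \<in> span P L par B" if y: "y \<in> P" for y
  proof (rule ccontr)
    assume n: "y \<notin> span P L par B"
    then have "y \<notin> B" using span_superset[of B] by blast
    moreover have "?Q (insert y B)"
      using independent_insert[OF _ y n] B by blast
    ultimately show False
      using max[of "insert y B"] B by simp
  qed
  then have "span P L par B = P"
    using span_least[OF subspace_UNIV BP] by blast
  then show ?thesis using that B by blast
qed

text \<open>Adding a point to a finite subspace stays inside a cylinder over it, and this is a union
  of one finite line for each of its points.\<close>

lemma order_two_finite:
  assumes ord: "has_order L 2" and X: "finite X" "X \<subseteq> P"
  shows "finite (span P L par X)"
proof -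
  have "\<exists>S. finite S \<and> subspace P L par S \<and> X \<subseteq> S"
    using X
  proof (induction X rule: finite_induct)
    case empty
    then show ?case using subspace_empty by blast
  next
    case (insert x X)
    then obtain S where S: "finite S" "subspace P L par S" "X \<subseteq> S" by auto
    have SP: "S \<subseteq> P" using S subspace_subset by blast
    show ?case
    proof (cases "S = {} \<or> x \<in> S")
      case True
      then consider "X = {}" | "x \<in> S"
        using S(3) by auto
      then show ?thesis
      proof cases
        case 1
        then show ?thesis
          using subspace_singleton[of x] insert.prems by (intro exI[of _ "{x}"]) simp
      next
        case 2
        then show ?thesis
          using S by (intro exI[of _ S]) simp
      qed
    next
      case False
      then obtain s where s: "s \<in> S" "s \<noteq> x" by blast
      obtain d where d: "d \<in> L" "s \<in> d" "x \<in> d"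
        using join_ex[of s x] s SP insert.prems by auto
      have "cylinder d S \<subseteq> (\<Union>s\<in>S. \<Union>{k. s \<in> k \<and> par k d})"
        unfolding cylinder_def by blast
      moreover have "finite (\<Union>{k. s \<in> k \<and> par k d})" if "s \<in> S" for s
      proof -
        have "s \<in> P" using that SP by auto
        then obtain k where k: "s \<in> k" "par k d" "k \<in> L" using parallel_ex[OF _ d(1)] by blast
        have "k' = k" if "s \<in> k'" "par k' d" for k'
          using parallel_unique[OF par_trans[OF that(2) par_sym[OF k(2)]] that(1) k(1)] .
        then have "{k. s \<in> k \<and> par k d} = {k}"
          using k(1,2) by fast
        moreover have "finite k" using ord k(3) unfolding has_order_def by simp
        ultimately show ?thesis by simp
      qed
      ultimately have "finite (cylinder d S)"
        using S(1) finite_subset[of "cylinder d S"] by (meson finite_UN_I)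
      moreover have "insert x X \<subseteq> cylinder d S"
        using cylinder_superset[OF d(1) SP] S cylinderI[OF par_refl[OF d(1)] d(3,2) s(1)] by simp
      ultimately show ?thesis
        using cylinder_subspace[OF S(2) d(1)] by (intro exI[of _ "cylinder d S"]) simp
    qed
  qed
  then show ?thesis
    using span_least finite_subset by metis
qed

end

section \<open>Bijections of lines\<close>

locale line_bijection =
  A: aff_space P L par + B: aff_space P' L' par'
  for P :: "'p set" and L :: "'p set set" and par :: "'p set \<Rightarrow> 'p set \<Rightarrow> bool"
    and P' :: "'q set" and L' :: "'q set set" and par' :: "'q set \<Rightarrow> 'q set \<Rightarrow> bool" +
  fixes phi :: "'p set \<Rightarrow> 'q set" and lam :: "'p \<Rightarrow> 'q"
  assumes dim: "affdim P' L' par' \<ge> 3"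
    and bij: "bij_betw phi L L'"
    and lam: "\<And>a b p. a \<in> L \<Longrightarrow> b \<in> L \<Longrightarrow> a \<noteq> b \<Longrightarrow> a \<inter> b = {p} \<Longrightarrow> phi a \<inter> phi b = {lam p}"
begin

section \<open>Dimension of the image space and incidence properties of \<open>lam\<close>\<close>

lemma phi_line: "a \<in> L \<Longrightarrow> phi a \<in> L'"
  using bij bij_betwE by metis

lemma phi_inj: "phi a = phi b \<Longrightarrow> a \<in> L \<Longrightarrow> b \<in> L \<Longrightarrow> a = b"
  using bij unfolding bij_betw_def by (metis inj_onD)

lemma phi_surj:
  assumes "l \<in> L'" obtains a where "a \<in> L" "l = phi a"
  using bij assms unfolding bij_betw_def by blast

text \<open>By \<open>B.steinitz\<close>, three or fewer spanning points would bound every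
  independent set by three points, and hence the dimension by two.\<close>

lemma spanning_card_ge_4:
  assumes "finite J" "J \<subseteq> P'" "span P' L' par' J = P'"
  shows "4 \<le> card J"
proof (rule ccontr)
  assume n: "\<not> 4 \<le> card J"
  have "card X \<le> Suc 2" if "finite X" "independent P' L' par' X" for X
  proof -
    have "X \<subseteq> span P' L' par' J"
      using that assms(3) unfolding independent_def by simp
    then show ?thesis
      using B.steinitz[OF that(1) assms(1) that(2) assms(2)] n by linarith
  qed
  then have "affdim P' L' par' \<le> enat 2"
    by (rule B.affdim_le)
  then have "3 \<le> enat 2"
    using dim order_trans by blast
  then show False
    by (simp add: numeral_eq_enat)
qed

text \<open>The points may coincide, so besides planes this also shows lines and single points to be
  proper.\<close>

lemma proper_span:
  assumes "x \<in> P'" "y \<in> P'" "z \<in> P'"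
  shows "span P' L' par' {x, y, z} \<noteq> P'"
proof
  assume "span P' L' par' {x, y, z} = P'"
  then have "4 \<le> card {x, y, z}"
    using spanning_card_ge_4[of "{x, y, z}"] assms by simp
  then show False
    by (simp add: card_insert_if split: if_splits)
qed

lemma image_point_off_line:
  assumes "l \<in> L'" obtains q where "q \<in> P'" "q \<notin> l"
proof -
  obtain x y where xy: "x \<in> l" "y \<in> l" "x \<noteq> y"
    using B.line_two_points[OF assms] .
  have P: "x \<in> P'" "y \<in> P'"
    using xy B.line_subset[OF assms] by auto
  let ?S = "span P' L' par' {x, x, y}"
  have S: "subspace P' L' par' ?S" "x \<in> ?S" "y \<in> ?S"
    using B.subspace_span[of "{x, x, y}"] B.span_superset[of "{x, x, y}"] P by simp_all
  have "l \<subseteq> ?S"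
    using B.subspace_line[OF S xy(3) assms xy(1,2)] .
  then have "l \<noteq> P'"
    using proper_span[OF P(1,1,2)] B.subspace_subset[OF S(1)] by auto
  then show ?thesis
    using that B.line_subset[OF assms] by auto
qed

lemma line_exists: obtains l where "l \<in> L"
proof -
  have "P' \<noteq> {}"
    using B.affine unfolding affine_space_def by simp
  then obtain x where x: "x \<in> P'" by auto
  have "span P' L' par' {x, x, x} \<subseteq> {x}"
    using B.span_least[OF B.subspace_singleton[OF x]] by simp
  then have "P' \<noteq> {x}"
    using proper_span[OF x x x] B.span_superset[of "{x, x, x}"] by auto
  then obtain y where y: "y \<in> P'" "x \<noteq> y" using x by auto
  obtain m where "m \<in> L'" using B.join_ex[OF x y] .
  then show ?thesis using phi_surj that by metis
qed

lemma point_off_line: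
  assumes l: "l \<in> L" obtains p where "p \<in> P" "p \<notin> l"
proof (cases "P = l")
  \<comment> \<open>A point off \<open>l\<close> is forced from the image side: if \<open>l\<close>
    were all of \<open>P\<close>, the preimage \<open>a\<close> of a line leaving
    \<open>phi l\<close> would lie in \<open>l\<close>, hence equal \<open>l\<close>.\<close>
  case True
  obtain q where q: "q \<in> P'" "q \<notin> phi l"
    using image_point_off_line[OF phi_line[OF l]] .
  obtain x where x: "x \<in> phi l" "x \<noteq> q"
    using B.line_other_point[OF phi_line[OF l]] .
  have "x \<in> P'" using B.line_subset[OF phi_line[OF l]] x by auto
  then obtain m where m: "m \<in> L'" "x \<in> m" "q \<in> m"
    using B.join_ex[OF _ q(1) x(2)] by metis
  obtain a where a: "a \<in> L" "m = phi a" using phi_surj[OF m(1)] .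
  obtain u v where uv: "u \<in> a" "v \<in> a" "u \<noteq> v" using A.line_two_points[OF a(1)] .
  have "a \<subseteq> l" using A.line_subset[OF a(1)] True by simp
  then have "a = l" using A.join_unique[OF uv(3) a(1) uv(1,2) l] uv by auto
  then show ?thesis using a m q by simp
next
  case False
  then show ?thesis using that A.line_subset[OF l] by auto
qed

lemma line_through:
  assumes "p \<in> P" obtains l where "l \<in> L" "p \<in> l"
proof -
  obtain m where m: "m \<in> L" using line_exists .
  obtain x where x: "x \<in> m" "x \<noteq> p" using A.line_other_point[OF m] .
  have "x \<in> P" using A.line_subset[OF m] x by auto
  then show ?thesis using A.join_ex[OF assms _ x(2)[symmetric]] that by metis
qed

lemma second_line:
  assumes "a \<in> L" "p \<in> a" obtains b where "b \<in> L" "p \<in> b" "b \<noteq> a"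
proof -
  obtain r where r: "r \<in> P" "r \<notin> a" using point_off_line[OF assms(1)] .
  have p: "p \<in> P" "p \<noteq> r" using A.line_subset[OF assms(1)] assms r by auto
  obtain b where "b \<in> L" "p \<in> b" "r \<in> b" using A.join_ex[OF p(1) r(1) p(2)] .
  then show ?thesis using that r by metis
qed

lemma lines_meet:
  assumes "a \<in> L" "b \<in> L" "a \<noteq> b" "p \<in> a" "p \<in> b"
  shows "phi a \<inter> phi b = {lam p}"
proof -
  have "x = p" if "x \<in> a" "x \<in> b" for x
    using A.join_unique[of x p a b] assms that by metis
  then have "a \<inter> b = {p}" using assms(4,5) by fast
  then show ?thesis using lam assms by metis
qed

lemma lam_in:
  assumes "a \<in> L" "p \<in> a" shows "lam p \<in> phi a"
proof -
  obtain b where "b \<in> L" "p \<in> b" "b \<noteq> a" using second_line[OF assms] .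
  then show ?thesis using lines_meet[of a b p] assms by auto
qed

lemma lam_point:
  assumes "p \<in> P" shows "lam p \<in> P'"
proof -
  obtain l where "l \<in> L" "p \<in> l" using line_through[OF assms] .
  then show ?thesis using lam_in B.line_subset[OF phi_line] by blast
qed

text \<open>A coincidence of two images spreads to all points off their joining line, and with a
  second pair to all of \<open>P\<close>. Then every line of \<open>L'\<close> passes through one
  point, which is impossible.\<close>

lemma lam_inj:
  assumes "p \<in> P" "q \<in> P" "lam p = lam q" shows "p = q"
proof (rule ccontr)
  assume pq: "p \<noteq> q"
  \<comment> \<open>The images of the distinct lines \<open>r p\<close> and \<open>r q\<close> meet
    in \<open>lam r\<close> alone, but both contain \<open>lam p = lam q\<close>.\<close>
  have off: "lam r = lam p"
    if h: "q \<in> P" "lam p = lam q" "p \<noteq> q" "g \<in> L" "p \<in> g" "q \<in> g" "r \<in> P" "r \<notin> g" for q g r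
  proof -
    have ne: "r \<noteq> p" "r \<noteq> q" using h by auto
    obtain a where a: "a \<in> L" "r \<in> a" "p \<in> a" using A.join_ex[OF h(7) assms(1) ne(1)] .
    obtain b where b: "b \<in> L" "r \<in> b" "q \<in> b" using A.join_ex[OF h(7,1) ne(2)] .
    have "a \<noteq> b" using A.join_unique[OF h(3) a(1,3) _ h(4-6)] a b h(8) by metis
    then have "phi a \<inter> phi b = {lam r}" using lines_meet a b by metis
    moreover have "lam p \<in> phi a" "lam p \<in> phi b"
      using lam_in[OF a(1,3)] lam_in[OF b(1,3)] h(2) by simp_all
    ultimately show ?thesis by (metis IntI singletonD)
  qed
  obtain g where g: "g \<in> L" "p \<in> g" "q \<in> g" using A.join_ex[OF assms(1,2) pq] .
  obtain s where s: "s \<in> P" "s \<notin> g" using point_off_line[OF g(1)] .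
  have ls: "lam p = lam s" using off[OF assms(2,3) pq g s] by simp
  have ps: "p \<noteq> s" using g s by auto
  obtain k where k: "k \<in> L" "p \<in> k" "s \<in> k" using A.join_ex[OF assms(1) s(1) ps] .
  \<comment> \<open>Points of \<open>g\<close> itself are reached with the pair \<open>p\<close>,
    \<open>s\<close> in place of \<open>p\<close>, \<open>q\<close>.\<close>
  have all: "lam r = lam p" if r: "r \<in> P" for r
  proof (cases "r \<in> g")
    case False
    then show ?thesis using off[OF assms(2,3) pq g r] by simp
  next
    case True
    show ?thesis
    proof (cases "r = p")
      case False
      then have "r \<notin> k" using A.join_unique[OF False g(1) True g(2) k(1) _ k(2)] k s by metis
      then show ?thesis using off[OF s(1) ls ps k r] by simp
    qed simp
  qed
  have every: "lam p \<in> m" if m: "m \<in> L'" for m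
  proof -
    obtain a where a: "a \<in> L" "m = phi a" using phi_surj[OF m] .
    obtain x y where "x \<in> a" "y \<in> a" using A.line_two_points[OF a(1)] by metis
    then show ?thesis using lam_in[OF a(1)] all A.line_subset[OF a(1)] a(2) by (metis subsetD)
  qed
  obtain z where z: "z \<in> P'" "z \<notin> phi g" using image_point_off_line[OF phi_line[OF g(1)]] .
  obtain y where y: "y \<in> phi g" "y \<noteq> lam p" using B.line_other_point[OF phi_line[OF g(1)]] .
  have "y \<in> P'" "y \<noteq> z" using B.line_subset[OF phi_line[OF g(1)]] y z by auto
  then obtain m where m: "m \<in> L'" "y \<in> m" "z \<in> m" using B.join_ex[OF _ z(1)] by metis
  have "m = phi g"
    using B.join_unique[OF y(2) m(1,2) every[OF m(1)] phi_line[OF g(1)] y(1)]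
      every[OF phi_line[OF g(1)]] by simp
  then show False using m z by simp
qed

text \<open>Join \<open>x\<close> to a point \<open>y\<close> of \<open>l\<close> by
  \<open>k\<close>: the images of \<open>k\<close> and \<open>l\<close> share the distinct points
  \<open>lam x\<close> and \<open>lam y\<close>, so they coincide, and \<open>phi\<close> is
  injective.\<close>

lemma lam_line:
  assumes "x \<in> P" "l \<in> L" "lam x \<in> phi l" shows "x \<in> l"
proof -
  obtain y z where y: "y \<in> l" using A.line_two_points[OF assms(2)] by metis
  have yP: "y \<in> P" using A.line_subset[OF assms(2)] y by auto
  show ?thesis
  proof (cases "x = y")
    case False
    obtain k where k: "k \<in> L" "x \<in> k" "y \<in> k" using A.join_ex[OF assms(1) yP False] .
    have "lam x \<noteq> lam y" using lam_inj[OF assms(1) yP] False by auto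
    then have "phi k = phi l"
      using B.join_unique[OF _ phi_line[OF k(1)] lam_in[OF k(1,2)] lam_in[OF k(1,3)]
          phi_line[OF assms(2)] assms(3) lam_in[OF assms(2) y]] by simp
    then show ?thesis using phi_inj k assms(2) by metis
  qed (use y in simp)
qed

lemma collineation_if_surj:
  assumes "P' \<subseteq> lam ` P" shows "collineation P L P' L' lam"
  unfolding collineation_def
proof (intro conjI ballI)
  show "bij_betw lam P P'"
    using assms lam_inj lam_point by (auto simp: bij_betw_def inj_on_def)
  fix x y z assume xyz: "x \<in> P" "y \<in> P" "z \<in> P"
  show "collinear L x y z \<longleftrightarrow> collinear L' (lam x) (lam y) (lam z)"
  proof
    assume "collinear L x y z"
    then obtain l where "l \<in> L" "x \<in> l" "y \<in> l" "z \<in> l" unfolding collinear_def by auto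
    then show "collinear L' (lam x) (lam y) (lam z)"
      unfolding collinear_def using lam_in phi_line by (intro bexI[of _ "phi l"]) auto
  next
    assume "collinear L' (lam x) (lam y) (lam z)"
    then obtain m where m: "m \<in> L'" "lam x \<in> m" "lam y \<in> m" "lam z \<in> m"
      unfolding collinear_def by auto
    obtain l where "l \<in> L" "m = phi l" using phi_surj[OF m(1)] .
    then show "collinear L x y z"
      unfolding collinear_def using lam_line m xyz by (intro bexI[of _ l]) auto
  qed
qed

section \<open>Surjectivity for order two and for finite spaces\<close>

lemma surj_if_order_two:
  assumes "has_order L' 2" shows "P' \<subseteq> lam ` P"
proof
  fix q assume q: "q \<in> P'"
  obtain p where p: "p \<in> P" using line_exists A.line_two_points A.line_subset by (metis subsetD)
  show "q \<in> lam ` P"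
  proof (cases "q = lam p")
    case False
    obtain m where m: "m \<in> L'" "q \<in> m" "lam p \<in> m"
      using B.join_ex[OF q lam_point[OF p] False] .
    obtain a where a: "a \<in> L" "m = phi a" using phi_surj[OF m(1)] .
    \<comment> \<open>The images of two points of \<open>a\<close> already exhaust the two-point
      line \<open>m\<close>, so \<open>q\<close> is one of them.\<close>
    obtain x y where xy: "x \<in> a" "y \<in> a" "x \<noteq> y" using A.line_two_points[OF a(1)] .
    have xyP: "x \<in> P" "y \<in> P" using A.line_subset[OF a(1)] xy by auto
    have sub: "{lam x, lam y} \<subseteq> m" using lam_in[OF a(1)] xy a(2) by simp
    have "finite m" "card m = 2" using assms m(1) unfolding has_order_def by auto
    moreover have "lam x \<noteq> lam y" using lam_inj[OF xyP] xy by metis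
    ultimately have "m = {lam x, lam y}" using card_subset_eq[OF _ sub] by auto
    then show ?thesis using m xyP by auto
  qed (use p in simp)
qed

lemma surj_if_finite:
  assumes fin: "finite P" shows "P' \<subseteq> lam ` P"
proof (rule subsetI, rule ccontr)
  fix q assume q: "q \<in> P'" "q \<notin> lam ` P"
  obtain l0 where l0: "l0 \<in> L" using line_exists .
  obtain p p2 where p: "p \<in> l0" using A.line_two_points[OF l0] by metis
  have pP: "p \<in> P" using A.line_subset[OF l0] p by auto
  have finL: "finite L" using fin A.line_subset finite_subset[of L "Pow P"] by auto
  define k where "k = card l0"
  have k: "card l = k" if "l \<in> L" for l
    unfolding k_def using A.lines_equal_card[OF fin that l0] .
  have finl: "finite l" if "l \<in> L" for l
    using A.line_subset[OF that] fin finite_subset by auto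
  define R where "R = {l \<in> L. p \<in> l}"
  define Q where "Q = {l \<in> L. q \<in> phi l}"
  have finRQ: "finite R" "finite Q" unfolding R_def Q_def using finL by auto
  \<comment> \<open>Parallels match the lines through \<open>lam p\<close> with the lines through
    \<open>q\<close>; pulled back along \<open>phi\<close>, this is a bijection between
    \<open>R\<close> and \<open>Q\<close>.\<close>
  have cardRQ: "card R = card Q"
  proof -
    have ex: "\<exists>m. m \<in> L \<and> z \<in> phi m \<and> par' (phi m) (phi l)" if z: "z \<in> P'" "l \<in> L" for z l
    proof -
      obtain n where n: "z \<in> n" "par' n (phi l)" "n \<in> L'"
        using B.parallel_ex[OF z(1) phi_line[OF z(2)]] .
      obtain m where "m \<in> L" "n = phi m" using phi_surj[OF n(3)] .
      then show ?thesis using n by auto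
    qed
    have un: "m = n" if h: "m \<in> L" "n \<in> L" "l \<in> L" "z \<in> phi m" "z \<in> phi n"
        "par' (phi m) (phi l)" "par' (phi l) (phi n)" for m n l z
      using B.parallel_unique[OF B.par_trans[OF h(6,7)] h(4,5)] phi_inj[OF _ h(1,2)] by metis
    obtain f where f: "\<And>l. l \<in> L \<Longrightarrow> f l \<in> L \<and> q \<in> phi (f l) \<and> par' (phi (f l)) (phi l)"
      using ex[OF q(1)] by metis
    obtain g where g: "\<And>l. l \<in> L \<Longrightarrow> g l \<in> L \<and> lam p \<in> phi (g l) \<and> par' (phi (g l)) (phi l)"
      using ex[OF lam_point[OF pP]] by metis
    have "bij_betw f R Q"
    proof (rule bij_betw_byWitness[where f' = g])
      show "\<forall>l\<in>R. g (f l) = l"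
      proof
        fix l assume "l \<in> R"
        then have l: "l \<in> L" "p \<in> l" unfolding R_def by auto
        have fl: "f l \<in> L" "par' (phi (f l)) (phi l)" using f[OF l(1)] by auto
        show "g (f l) = l"
          using un[OF _ l(1) fl(1) _ lam_in[OF l] _ fl(2)] g[OF fl(1)] by metis
      qed
      show "\<forall>l\<in>Q. f (g l) = l"
      proof
        fix l assume "l \<in> Q"
        then have l: "l \<in> L" "q \<in> phi l" unfolding Q_def by auto
        have gl: "g l \<in> L" "par' (phi (g l)) (phi l)" using g[OF l(1)] by auto
        show "f (g l) = l"
          using un[OF _ l(1) gl(1) _ l(2) _ gl(2)] f[OF gl(1)] by metis
      qed
      show "f ` R \<subseteq> Q" using f unfolding R_def Q_def by auto
      show "g ` Q \<subseteq> R" using g lam_line[OF pP] unfolding R_def Q_def by auto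
    qed
    then show ?thesis by (rule bij_betw_same_card)
  qed
  have PQ: "P = \<Union>Q"
  proof
    show "\<Union>Q \<subseteq> P" unfolding Q_def using A.line_subset by auto
    show "P \<subseteq> \<Union>Q"
    proof
      fix x assume x: "x \<in> P"
      then have ne: "q \<noteq> lam x" using q by auto
      obtain m where m: "m \<in> L'" "q \<in> m" "lam x \<in> m"
        using B.join_ex[OF q(1) lam_point[OF x] ne] .
      obtain a where a: "a \<in> L" "m = phi a" using phi_surj[OF m(1)] .
      then show "x \<in> \<Union>Q" unfolding Q_def using lam_line[OF x a(1)] m by auto
    qed
  qed
  \<comment> \<open>Distinct images meet in one point, so a common point \<open>x\<close> of
    \<open>a\<close> and \<open>b\<close> would give \<open>q = lam x\<close>.\<close>
  have disjQ: "a \<inter> b = {}" if "a \<in> Q" "b \<in> Q" "a \<noteq> b" for a b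
  proof (rule ccontr)
    assume "a \<inter> b \<noteq> {}"
    then obtain x where x: "x \<in> a" "x \<in> b" by auto
    have ab: "a \<in> L" "b \<in> L" "q \<in> phi a" "q \<in> phi b" using that unfolding Q_def by auto
    have "phi a \<inter> phi b = {lam x}" using lines_meet[OF ab(1,2) that(3) x] .
    then have "q = lam x" using ab by (metis IntI singletonD)
    then show False using q x A.line_subset[OF ab(1)] by auto
  qed
  have "card (\<Union>Q) = (\<Sum>l\<in>Q. card l)"
    using card_Union_disjoint[of Q] disjQ finl unfolding Q_def
    by (auto simp: pairwise_def disjnt_def)
  also have "\<dots> = card Q * k" using k unfolding Q_def by simp
  finally have c1: "card P = card Q * k" using PQ by simp
  have PR: "P - {p} = (\<Union>l\<in>R. l - {p})"
  proof
    show "(\<Union>l\<in>R. l - {p}) \<subseteq> P - {p}" unfolding R_def using A.line_subset by auto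
    show "P - {p} \<subseteq> (\<Union>l\<in>R. l - {p})"
    proof
      fix x assume "x \<in> P - {p}"
      then have x: "x \<in> P" "p \<noteq> x" by auto
      obtain m where "m \<in> L" "p \<in> m" "x \<in> m" using A.join_ex[OF pP x] .
      then show "x \<in> (\<Union>l\<in>R. l - {p})" unfolding R_def using x by auto
    qed
  qed
  have disjR: "(a - {p}) \<inter> (b - {p}) = {}" if ab: "a \<in> R" "b \<in> R" "a \<noteq> b" for a b
  proof -
    have "x = p" if "x \<in> a" "x \<in> b" for x
      using A.join_unique[of x p a b] ab that unfolding R_def by auto
    then show ?thesis by fast
  qed
  have "card (\<Union>l\<in>R. l - {p}) = (\<Sum>l\<in>R. card (l - {p}))"
    using disjR finl finRQ unfolding R_def by (intro card_UN_disjoint) auto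
  also have "\<dots> = (\<Sum>l\<in>R. k - 1)"
    using k finl unfolding R_def by (intro sum.cong) auto
  finally have "card (P - {p}) = card R * (k - 1)" using PR by simp
  then have c2: "card P = card R * (k - 1) + 1"
    using card.remove[OF fin pP] by linarith
  \<comment> \<open>Positivity guards the truncated subtraction \<open>k - 1\<close>. Comparing the
    two counts leaves \<open>card R = 1\<close>, although two lines pass through
    \<open>p\<close>.\<close>
  have "k > 0" unfolding k_def using p finl[OF l0] card_gt_0_iff by auto
  then have "card R * k = card R * (k - 1) + card R" by (cases k) auto
  then have "card R = 1" using c1 c2 unfolding cardRQ by linarith
  moreover have "l0 \<in> R" unfolding R_def using l0 p by simp
  ultimately have "R = {l0}" by (metis card_1_singletonE singletonD)
  moreover obtain b where "b \<in> L" "p \<in> b" "b \<noteq> l0" using second_line[OF l0 p] .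
  ultimately show False unfolding R_def by auto
qed

section \<open>Parallel lines have parallel images\<close>

lemma image_not_in_proper_subspace:
  assumes E: "subspace P' L' par' E" "E \<noteq> P'"
  obtains x where "x \<in> P" "lam x \<notin> E"
proof (rule ccontr)
  assume "\<not> thesis"
  then have in_E: "lam x \<in> E" if "x \<in> P" for x
    using that \<open>\<And>x. x \<in> P \<Longrightarrow> lam x \<notin> E \<Longrightarrow> thesis\<close> by metis
  \<comment> \<open>Every line of \<open>L'\<close> is some \<open>phi a\<close> and carries two
    image points, so \<open>E\<close> contains all lines once it contains the image.\<close>
  have sub: "m \<subseteq> E" if m: "m \<in> L'" for m
  proof -
    obtain a where a: "a \<in> L" "m = phi a" using phi_surj[OF m] .
    obtain x y where xy: "x \<in> a" "y \<in> a" "x \<noteq> y" using A.line_two_points[OF a(1)] .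
    have xyP: "x \<in> P" "y \<in> P" using A.line_subset[OF a(1)] xy by auto
    have "lam x \<noteq> lam y" using lam_inj[OF xyP] xy(3) by metis
    moreover have "lam x \<in> m" "lam y \<in> m" using lam_in[OF a(1)] xy(1,2) a(2) by simp_all
    ultimately show ?thesis
      using B.subspace_line[OF E(1) in_E[OF xyP(1)] in_E[OF xyP(2)] _ m] by metis
  qed
  obtain l where l: "l \<in> L'" using line_exists phi_line by metis
  have "z \<in> E" if z: "z \<in> P'" for z
  proof -
    obtain x where x: "x \<in> l" "x \<noteq> z" using B.line_other_point[OF l] .
    have "x \<in> P'" using B.line_subset[OF l] x by auto
    then obtain m where "m \<in> L'" "z \<in> m" using B.join_ex[OF z _ x(2)[symmetric]] by metis
    then show ?thesis using sub[of m] by auto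
  qed
  then show False using E(2) B.subspace_subset[OF E(1)] by auto
qed

text \<open>A third point \<open>w\<close> on a transversal of \<open>a\<close> and \<open>b\<close>
  yields two lines through \<open>w\<close> crossing both. Their images cross \<open>phi a\<close>
  and \<open>phi b\<close> in the same way, and \<open>B.veblen\<close> applies.\<close>

lemma phi_parallel_or_meet:
  assumes ord: "\<not> has_order L 2" and ab: "par a b"
  shows "par' (phi a) (phi b) \<or> (\<exists>q. q \<in> phi a \<and> q \<in> phi b)"
proof (cases "a = b")
  case True
  then show ?thesis using B.par_refl[OF phi_line] A.par_line(1)[OF ab] by auto
next
  case False
  have L: "a \<in> L" "b \<in> L" using A.par_line[OF ab] .
  have disj: "x \<notin> b" if "x \<in> a" for x using A.parallel_unique[OF ab that] False by auto
  obtain p where p: "p \<in> a" using A.line_two_points[OF L(1)] by metis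
  obtain r r2 where r: "r \<in> b" "r2 \<in> b" "r \<noteq> r2" using A.line_two_points[OF L(2)] .
  have P: "p \<in> P" "r \<in> P" "r2 \<in> P" using A.line_subset L p r by auto
  have pr: "p \<noteq> r" using disj[OF p] r by auto
  obtain k1 where k1: "k1 \<in> L" "p \<in> k1" "r \<in> k1" using A.join_ex[OF P(1,2) pr] .
  obtain w where w: "w \<in> k1" "w \<noteq> p" "w \<noteq> r" using A.third_point[OF ord k1(1)] .
  have wP: "w \<in> P" using A.line_subset[OF k1(1)] w by auto
  have wa: "w \<notin> a" using A.join_unique[OF w(2) k1(1) w(1) k1(2) L(1) _ p] k1 disj r by metis
  have wb: "w \<notin> b" using A.join_unique[OF w(3) k1(1) w(1) k1(3) L(2) _ r(1)] k1 disj p by metis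
  have wr: "w \<noteq> r2" using wb r by auto
  obtain k2 where k2: "k2 \<in> L" "w \<in> k2" "r2 \<in> k2" using A.join_ex[OF wP P(3) wr] .
  have r2k1: "r2 \<notin> k1" using A.join_unique[OF r(3) k1(1,3) _ L(2) r(1,2)] w wb by metis
  \<comment> \<open>The triangle axiom acts as a homothety with centre \<open>w\<close> carrying
    \<open>r\<close> to \<open>p\<close>: the line \<open>b\<close> becomes \<open>a\<close>, so
    \<open>k2\<close> meets \<open>a\<close>.\<close>
  obtain u where u: "u \<in> a" "u \<in> k2"
    using A.triangle[OF w(3)[symmetric] w(2)[symmetric] k1(3) w(1) r2k1 k1(2) w(1)
        A.par_refl[OF k1(1)] L(2) r(1,2) k2 p ab k2(2) A.par_refl[OF k2(1)]] .
  have uP: "u \<in> P" using A.line_subset[OF L(1)] u by auto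
  have uw: "u \<noteq> w" using u wa by auto
  have k12: "phi k1 \<noteq> phi k2" using phi_inj[OF _ k1(1) k2(1)] k2 r2k1 by metis
  have ne: "lam p \<noteq> lam w" "lam u \<noteq> lam w" "lam r \<noteq> lam w" "lam r2 \<noteq> lam w"
    using lam_inj[OF P(1) wP] lam_inj[OF uP wP] lam_inj[OF P(2) wP] lam_inj[OF P(3) wP] w uw wr
    by metis+
  show ?thesis
    using B.veblen[OF phi_line[OF k1(1)] phi_line[OF k2(1)] k12 lam_in[OF k1(1) w(1)]
        lam_in[OF k2(1,2)] phi_line[OF L(1)] lam_in[OF L(1) p] lam_in[OF L(1) u(1)]
        lam_in[OF k1(1,2)] lam_in[OF k2(1) u(2)] ne(1,2) phi_line[OF L(2)]
        lam_in[OF L(2) r(1)] lam_in[OF L(2) r(2)] lam_in[OF k1(1,3)] lam_in[OF k2(1,3)] ne(3,4)] .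
qed

lemma parallel_class_is_pencil:
  assumes ord: "\<not> has_order L 2" and ab: "par a b" "\<not> par' (phi a) (phi b)"
  obtains q where "q \<in> P'" "\<And>c. c \<in> L \<Longrightarrow> q \<in> phi c \<longleftrightarrow> par c a"
proof -
  have L: "a \<in> L" "b \<in> L" using A.par_line[OF ab(1)] .
  note L' = phi_line[OF L(1)] phi_line[OF L(2)]
  have ne: "a \<noteq> b" using ab B.par_refl[OF L'(1)] by auto
  obtain q where q: "q \<in> phi a" "q \<in> phi b" using phi_parallel_or_meet[OF ord ab(1)] ab(2) by auto
  have qP: "q \<in> P'" using B.line_subset[OF L'(1)] q by auto
  have qlam: "q \<noteq> lam x" if x: "x \<in> P" for x
  proof
    assume "q = lam x"
    then have "x \<in> a" "x \<in> b" using lam_line[OF x] L q by auto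
    then show False using A.parallel_unique[OF ab(1)] ne by auto
  qed
  obtain u where u: "u \<in> phi a" "u \<noteq> q" using B.line_other_point[OF L'(1)] .
  obtain v where v: "v \<in> phi b" "v \<noteq> q" using B.line_other_point[OF L'(2)] .
  have uvP: "u \<in> P'" "v \<in> P'" using B.line_subset L' u v by auto
  define E where "E = span P' L' par' {q, u, v}"
  have E: "subspace P' L' par' E" "q \<in> E" "u \<in> E" "v \<in> E"
    unfolding E_def using B.subspace_span[of "{q, u, v}"] B.span_superset[of "{q, u, v}"] qP uvP
    by simp_all
  have aE: "phi a \<subseteq> E" "phi b \<subseteq> E"
    using B.subspace_line[OF E(1,3,2) u(2) L'(1) u(1) q(1)]
      B.subspace_line[OF E(1,4,2) v(2) L'(2) v(1) q(2)] by auto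
  have npar: "\<not> par' (phi c) n" if n: "\<not> phi c \<subseteq> E" "n \<subseteq> E" "y \<in> phi c" "y \<in> E" for c n y
    using B.subspace_parallel[OF E(1) n(4,2) _ n(3)] n(1) by metis
  have uniq: "y = z"
    if "c \<in> L" "\<not> phi c \<subseteq> E" "y \<in> phi c" "y \<in> E" "z \<in> phi c" "z \<in> E" for c y z
    using B.subspace_line[OF E(1) that(4,6) _ phi_line[OF that(1)] that(3,5)] that(2) by metis
  \<comment> \<open>If \<open>phi c\<close> leaves the plane \<open>E\<close> of
    \<open>phi a\<close> and \<open>phi b\<close>, it has a single point there: missing
    \<open>E\<close>, it would be parallel to both lines, making them parallel to each other. It
    meets both lines in that point, which is therefore \<open>q\<close>.\<close>
  have off: "q \<in> phi c" if c: "par c a" "\<not> phi c \<subseteq> E" for c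
  proof -
    have cL: "c \<in> L" "par c b" using A.par_line(1)[OF c(1)] A.par_trans[OF c(1) ab(1)] .
    have "\<exists>z. z \<in> phi c \<and> z \<in> E"
    proof (rule ccontr)
      assume "\<nexists>z. z \<in> phi c \<and> z \<in> E"
      then have "par' (phi c) (phi a)" "par' (phi c) (phi b)"
        using phi_parallel_or_meet[OF ord c(1)] phi_parallel_or_meet[OF ord cL(2)] aE by auto
      then show False using ab(2) B.par_trans B.par_sym by metis
    qed
    then obtain z where z: "z \<in> phi c" "z \<in> E" by auto
    have "z \<in> phi a"
      using phi_parallel_or_meet[OF ord c(1)] npar[OF c(2) aE(1) z] uniq[OF cL(1) c(2) z] aE(1)
      by (metis subsetD)
    moreover have "z \<in> phi b"
      using phi_parallel_or_meet[OF ord cL(2)] npar[OF c(2) aE(2) z] uniq[OF cL(1) c(2) z] aE(2)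
      by (metis subsetD)
    ultimately have "z = q"
      using B.join_unique[OF _ L'(1) _ q(1) L'(2) _ q(2)] ab(2) B.par_refl[OF L'(1)] by metis
    then show ?thesis using z by simp
  qed
  \<comment> \<open>\<open>E\<close> is proper, so the parallel class has a member \<open>c0\<close>
    whose image leaves \<open>E\<close>.\<close>
  obtain x where x: "x \<in> P" "lam x \<notin> E"
    using image_not_in_proper_subspace[OF E(1)] proper_span[OF qP uvP] unfolding E_def by metis
  obtain c0 where c0: "x \<in> c0" "par c0 a" "c0 \<in> L" using A.parallel_ex[OF x(1) L(1)] .
  have c0E: "\<not> phi c0 \<subseteq> E" using lam_in[OF c0(3,1)] x by auto
  have qc0: "q \<in> phi c0" using off[OF c0(2) c0E] .
  \<comment> \<open>Images inside \<open>E\<close> are compared with \<open>phi c0\<close>, which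
    meets \<open>E\<close> only in \<open>q\<close>: the two are not parallel, so they meet, and
    only \<open>q\<close> is available.\<close>
  have fwd: "q \<in> phi c" if c: "par c a" for c
  proof (cases "phi c \<subseteq> E")
    case True
    have "par c0 c" using A.par_trans[OF c0(2) A.par_sym[OF c]] .
    then obtain z where z: "z \<in> phi c0" "z \<in> phi c"
      using phi_parallel_or_meet[OF ord] npar[OF c0E True qc0 E(2)] by metis
    then show ?thesis using uniq[OF c0(3) c0E qc0 E(2)] True by auto
  next
    case False
    then show ?thesis using off[OF c] by simp
  qed
  \<comment> \<open>Conversely, if \<open>phi c\<close> passes through \<open>q\<close>, it shares
    both \<open>q\<close> and \<open>lam x\<close> with the image of the parallel to
    \<open>a\<close> through a point \<open>x\<close> of \<open>c\<close>.\<close>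
  have "par c a" if c: "c \<in> L" "q \<in> phi c" for c
  proof -
    obtain x where x: "x \<in> c" using A.line_two_points[OF c(1)] by metis
    have xP: "x \<in> P" using A.line_subset[OF c(1)] x by auto
    obtain d where d: "x \<in> d" "par d a" "d \<in> L" using A.parallel_ex[OF xP L(1)] .
    have "phi c = phi d"
      using B.join_unique[OF qlam[OF xP] phi_line[OF c(1)] c(2) lam_in[OF c(1) x]
          phi_line[OF d(3)] fwd[OF d(2)] lam_in[OF d(3,1)]] .
    then show ?thesis using phi_inj[OF _ c(1) d(3)] d by metis
  qed
  then show ?thesis using that[OF qP] fwd by metis
qed

lemma phi_parallel:
  assumes ord: "\<not> has_order L 2" and ab: "par a b"
  shows "par' (phi a) (phi b)"
proof (rule ccontr)
  assume "\<not> par' (phi a) (phi b)"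
  then obtain q where q: "q \<in> P'" "\<And>c. c \<in> L \<Longrightarrow> q \<in> phi c \<longleftrightarrow> par c a"
    using parallel_class_is_pencil[OF ord ab] by metis
  have aL: "a \<in> L" using A.par_line(1)[OF ab] .
  obtain p where p: "p \<in> a" using A.line_two_points[OF aL] by metis
  obtain d where d: "d \<in> L" "p \<in> d" "d \<noteq> a" using second_line[OF aL p] .
  have da: "\<not> par d a" using A.parallel_unique[OF _ d(2) p] d(3) by metis
  show False
  proof (cases "\<exists>e. par d e \<and> \<not> par' (phi d) (phi e)")
    \<comment> \<open>With two pencils, the line joining their centres would belong to both parallel
      classes.\<close>
    case True
    then obtain r where r: "r \<in> P'" "\<And>c. c \<in> L \<Longrightarrow> r \<in> phi c \<longleftrightarrow> par c d"
      using parallel_class_is_pencil[OF ord] by metis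
    have "q \<noteq> r" using q(2)[OF d(1)] r(2)[OF d(1)] da A.par_refl[OF d(1)] by metis
    then obtain m where m: "m \<in> L'" "q \<in> m" "r \<in> m" using B.join_ex[OF q(1) r(1)] by metis
    obtain k where k: "k \<in> L" "m = phi k" using phi_surj[OF m(1)] .
    have "par k a" "par k d" using q(2)[OF k(1)] r(2)[OF k(1)] m k by simp_all
    then show False using da A.par_trans A.par_sym by metis
  next
    case False
    \<comment> \<open>The parallel to \<open>phi d\<close> through \<open>q\<close> comes from some
      \<open>h\<close> parallel to \<open>a\<close>. Through a point \<open>x\<close> of
      \<open>h\<close>, the parallel \<open>k\<close> to \<open>d\<close> has an image parallel to
      \<open>m\<close> that shares \<open>lam x\<close> with it, so \<open>h = k\<close>.\<close>
    obtain m where m: "q \<in> m" "par' m (phi d)" "m \<in> L'" using B.parallel_ex[OF q(1) phi_line[OF d(1)]] .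
    obtain h where h: "h \<in> L" "m = phi h" using phi_surj[OF m(3)] .
    have ha: "par h a" using q(2)[OF h(1)] m h by simp
    obtain x where x: "x \<in> h" using A.line_two_points[OF h(1)] by metis
    have xP: "x \<in> P" using A.line_subset[OF h(1)] x by auto
    obtain k where k: "x \<in> k" "par k d" "k \<in> L" using A.parallel_ex[OF xP d(1)] .
    have "par' (phi d) (phi k)" using False A.par_sym[OF k(2)] by metis
    then have "m = phi k"
      using B.parallel_unique[OF B.par_trans[OF m(2)]] lam_in[OF h(1) x] lam_in[OF k(3,1)] h(2) by metis
    then have "h = k" using phi_inj[OF _ h(1) k(3)] h(2) by metis
    then show False using da ha k(2) A.par_trans A.par_sym by metis
  qed
qed

section \<open>Finite dimensions\<close>

lemma span_image:
  assumes ord: "\<not> has_order L 2" and X: "X \<subseteq> P" "span P L par X = P"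
  shows "span P' L' par' (lam ` X) = P'"
proof (rule ccontr)
  let ?S = "span P' L' par' (lam ` X)"
  assume ne: "?S \<noteq> P'"
  have XP: "lam ` X \<subseteq> P'" using X lam_point by auto
  have S: "subspace P' L' par' ?S" using B.subspace_span[OF XP] .
  have on_line: "lam z \<in> ?S" if h: "l \<in> L" "p \<in> l" "q \<in> l" "p \<noteq> q" "lam p \<in> ?S" "lam q \<in> ?S" "z \<in> l"
    for l p q z
  proof -
    have "p \<in> P" "q \<in> P" using A.line_subset[OF h(1)] h by auto
    then have "lam p \<noteq> lam q" using lam_inj h(4) by metis
    then have "phi l \<subseteq> ?S"
      using B.subspace_line[OF S h(5,6) _ phi_line[OF h(1)] lam_in[OF h(1,2)] lam_in[OF h(1,3)]]
      by simp
    then show ?thesis using lam_in[OF h(1,7)] by auto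
  qed
  \<comment> \<open>The preimage of a subspace is a subspace; its clause on parallels is where
    \<open>phi_parallel\<close> enters. Containing \<open>X\<close>, it is all of
    \<open>P\<close>.\<close>
  have "subspace P L par {x \<in> P. lam x \<in> ?S}"
  proof (rule A.subspaceI)
    fix p l m z assume h: "p \<in> {x \<in> P. lam x \<in> ?S}" "l \<subseteq> {x \<in> P. lam x \<in> ?S}" "par m l" "p \<in> m" "z \<in> m"
    have L: "m \<in> L" "l \<in> L" using A.par_line[OF h(3)] .
    obtain u v where uv: "u \<in> l" "v \<in> l" "u \<noteq> v" using A.line_two_points[OF L(2)] .
    have uvS: "u \<in> P" "v \<in> P" "lam u \<in> ?S" "lam v \<in> ?S" using uv h(2) by auto
    have "lam u \<noteq> lam v" using lam_inj[OF uvS(1,2)] uv(3) by metis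
    then have "phi l \<subseteq> ?S"
      using B.subspace_line[OF S uvS(3,4) _ phi_line[OF L(2)] lam_in[OF L(2) uv(1)] lam_in[OF L(2) uv(2)]]
      by simp
    then have "phi m \<subseteq> ?S"
      using B.subspace_parallel[OF S _ _ phi_parallel[OF ord h(3)] lam_in[OF L(1) h(4)]] h(1) by simp
    then show "z \<in> {x \<in> P. lam x \<in> ?S}"
      using lam_in[OF L(1) h(5)] A.line_subset[OF L(1)] h(5) by auto
  next
    fix p q l z assume h: "p \<in> {x \<in> P. lam x \<in> ?S}" "q \<in> {x \<in> P. lam x \<in> ?S}" "p \<noteq> q" "l \<in> L"
      "p \<in> l" "q \<in> l" "z \<in> l"
    show "z \<in> {x \<in> P. lam x \<in> ?S}"
      using on_line[OF h(4-6,3) _ _ h(7)] h(1,2) A.line_subset[OF h(4)] h(7) by auto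
  qed auto
  moreover have "X \<subseteq> {x \<in> P. lam x \<in> ?S}"
    using X(1) B.span_superset[of "lam ` X"] by auto
  ultimately have "P \<subseteq> {x \<in> P. lam x \<in> ?S}" using A.span_least X(2) by metis
  moreover obtain x where "x \<in> P" "lam x \<notin> ?S" using image_not_in_proper_subspace[OF S ne] .
  ultimately show False by auto
qed

lemma meeting_images_meet:
  assumes ord: "\<not> has_order L 2" and dims: "affdim P L par \<le> affdim P' L' par'" "affdim P' L' par' < \<infinity>"
    and ab: "a \<in> L" "b \<in> L" "a \<noteq> b" and q: "q \<in> phi a" "q \<in> phi b"
  shows "q \<in> lam ` P"
proof (rule ccontr)
  assume nq: "q \<notin> lam ` P"
  note L' = phi_line[OF ab(1)] phi_line[OF ab(2)]
  have disj: "x \<notin> b" if x: "x \<in> a" for x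
  proof
    assume "x \<in> b"
    then have "q = lam x" using lines_meet[OF ab x] q by (metis IntI singletonD)
    then show False using nq A.line_subset[OF ab(1)] x by auto
  qed
  \<comment> \<open>Otherwise the images would be parallel lines through \<open>q\<close>, hence
    equal.\<close>
  have npar: "\<not> par a b"
    using B.parallel_unique[OF phi_parallel[OF ord] q] phi_inj[OF _ ab(1,2)] ab(3) by metis
  obtain a1 a2 where a: "a1 \<in> a" "a2 \<in> a" "a2 \<noteq> a1" using A.line_two_points[OF ab(1)] by metis
  obtain b1 where b: "b1 \<in> b" using A.line_two_points[OF ab(2)] by metis
  have P: "a1 \<in> P" "a2 \<in> P" "b1 \<in> P" using A.line_subset ab a b by auto
  obtain c where c: "a1 \<in> c" "par c b" "c \<in> L" using A.parallel_ex[OF P(1) ab(2)] .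
  have ca: "c \<noteq> a" using c(2) npar by metis
  obtain c1 where c1: "c1 \<in> c" "c1 \<noteq> a1" using A.line_other_point[OF c(3)] .
  have c1P: "c1 \<in> P" using A.line_subset[OF c(3)] c1 by auto
  have c1a: "c1 \<notin> a" using A.join_unique[OF c1(2) c(3) c1(1) c(1) ab(1) _ a(1)] ca by metis
  have "subspace P L par a" using A.line_is_subspace[OF ab(1)] .
  then have s3: "span P L par {c1, a2, a1} \<subseteq> A.cylinder c a"
    using A.span_insert_subset_cylinder[OF _ _ a(1) c(3,1) c1(1), of "{a2, a1}"] a by simp
  have s2: "span P L par {a2, a1} \<subseteq> a"
    using A.span_least[OF A.line_is_subspace[OF ab(1)]] a by simp
  have s1: "span P L par {a1} \<subseteq> {a1}"
    using A.span_least[OF A.subspace_singleton[OF P(1)]] by simp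
  have s0: "span P L par {} \<subseteq> {}" using A.span_least[OF A.subspace_empty] by simp
  \<comment> \<open>The cylinder contains the plane through \<open>a\<close> and \<open>c\<close>. A
    parallel to \<open>c\<close> through \<open>b1\<close> can only be \<open>b\<close>, which
    misses \<open>a\<close>; so the four chosen points are independent.\<close>
  have b1c: "b1 \<notin> A.cylinder c a"
  proof
    assume "b1 \<in> A.cylinder c a"
    then obtain k s where k: "par k c" "b1 \<in> k" "s \<in> k" "s \<in> a" unfolding A.cylinder_def by auto
    then have "k = b" using A.parallel_unique[OF A.par_trans[OF k(1) c(2)] k(2) b] by simp
    then show False using disj k by auto
  qed
  have "independent P L par {}" unfolding independent_def by simp
  then have "independent P L par {a1}" using A.independent_insert[of "{}" a1] P s0 by auto
  then have "independent P L par {a2, a1}" using A.independent_insert[of "{a1}" a2] P s1 a by auto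
  then have "independent P L par {c1, a2, a1}"
    using A.independent_insert[of "{a2, a1}" c1] c1P s2 c1a by auto
  then have "independent P L par {b1, c1, a2, a1}"
    using A.independent_insert[of "{c1, a2, a1}" b1] P s3 b1c by auto
  moreover have "affdim P L par < \<infinity>" using dims by (rule le_less_trans)
  ultimately obtain X where X: "finite X" "independent P L par X" "{b1, c1, a2, a1} \<subseteq> X"
    "span P L par X = P"
    using A.extend_to_basis[of "{b1, c1, a2, a1}"] by auto
  have XP: "X \<subseteq> P" using X(2) unfolding independent_def by simp
  \<comment> \<open>Dropping \<open>b1\<close> loses nothing in the image: the span of
    \<open>J\<close> contains \<open>phi a\<close> and \<open>phi c\<close>, hence \<open>q\<close>,
    hence \<open>phi b\<close> as the parallel to \<open>phi c\<close> through \<open>q\<close>, and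
    so \<open>lam b1\<close>.\<close>
  define J where "J = lam ` (X - {b1})"
  have JP: "J \<subseteq> P'" unfolding J_def using XP lam_point by auto
  have J: "subspace P' L' par' (span P' L' par' J)" using B.subspace_span[OF JP] .
  have "b1 \<noteq> c1" "b1 \<noteq> a2" "b1 \<noteq> a1"
    using b1c A.span_superset[of "{c1, a2, a1}"] s3 by auto
  then have inJ: "lam c1 \<in> span P' L' par' J" "lam a2 \<in> span P' L' par' J" "lam a1 \<in> span P' L' par' J"
    using B.span_superset[of J] X(3) unfolding J_def by auto
  have "lam a2 \<noteq> lam a1" "lam c1 \<noteq> lam a1"
    using lam_inj[OF P(2,1)] lam_inj[OF c1P P(1)] a(3) c1(2) by metis+
  then have "phi a \<subseteq> span P' L' par' J" "phi c \<subseteq> span P' L' par' J"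
    using B.subspace_line[OF J inJ(2,3) _ L'(1) lam_in[OF ab(1) a(2)] lam_in[OF ab(1) a(1)]]
      B.subspace_line[OF J inJ(1,3) _ phi_line[OF c(3)] lam_in[OF c(3) c1(1)] lam_in[OF c(3,1)]]
    by simp_all
  then have "phi b \<subseteq> span P' L' par' J"
    using B.subspace_parallel[OF J _ _ phi_parallel[OF ord A.par_sym[OF c(2)]] q(2)] q(1) by auto
  then have "lam b1 \<in> span P' L' par' J" using lam_in[OF ab(2) b] by auto
  then have "lam ` X \<subseteq> span P' L' par' J"
    using B.span_superset[of J] unfolding J_def by auto
  then have "span P' L' par' (lam ` X) \<subseteq> span P' L' par' J"
    using B.span_least[OF J] by simp
  then have spanJ: "P' \<subseteq> span P' L' par' J" using span_image[OF ord XP X(4)] by simp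
  have finJ: "finite J" unfolding J_def using X by simp
  \<comment> \<open>The basis \<open>X\<close> has \<open>n + 2\<close> points, so the first space
    has dimension at least \<open>n + 1\<close>; the at most \<open>n + 1\<close> points of
    \<open>J\<close> bound the second dimension by \<open>n\<close>.\<close>
  obtain n where n: "card X = Suc (Suc n)"
  proof -
    have "card {a2, a1} \<le> card X" using X(1,3) by (intro card_mono) auto
    then have "2 \<le> card X" using a(3) by simp
    then show ?thesis using that[of "card X - 2"] by simp
  qed
  have "card J \<le> card (X - {b1})" unfolding J_def using X(1) by (intro card_image_le) simp
  also have "\<dots> = Suc n" using X(1,3) n by simp
  finally have cJ: "card J \<le> Suc n" .
  have "affdim P' L' par' \<le> enat n"
  proof (rule B.affdim_le)
    fix I assume I: "finite I" "independent P' L' par' I"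
    have "I \<subseteq> span P' L' par' J" using I(2) spanJ unfolding independent_def by auto
    then show "card I \<le> Suc n" using B.steinitz[OF I(1) finJ I(2) JP] cJ by simp
  qed
  moreover have "enat (Suc n) \<le> affdim P L par"
    using A.independent_card_le_affdim[OF X(1,2)] n by (simp add: one_enat_def)
  ultimately have "enat (Suc n) \<le> enat n" using dims(1) order_trans by metis
  then show False by simp
qed

lemma surj_if_affdim_le:
  assumes dims: "affdim P L par \<le> affdim P' L' par'" "affdim P' L' par' < \<infinity>"
  shows "P' \<subseteq> lam ` P"
proof (cases "has_order L 2")
  \<comment> \<open>With two points on each line, finite dimension makes \<open>P\<close>
    finite.\<close>
  case True
  have "independent P L par {}" unfolding independent_def by simp
  then obtain X where X: "finite X" "independent P L par X" "span P L par X = P"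
    using A.extend_to_basis[of "{}"] le_less_trans[OF dims] by auto
  then have "finite P"
    using A.order_two_finite[OF True X(1)] unfolding independent_def by simp
  then show ?thesis by (rule surj_if_finite)
next
  case False
  show ?thesis
  proof
    fix q assume q: "q \<in> P'"
    obtain l where l: "l \<in> L'" using line_exists phi_line by metis
    obtain m where m: "q \<in> m" "par' m l" "m \<in> L'" using B.parallel_ex[OF q l] .
    \<comment> \<open>Each point of \<open>P'\<close> is the intersection of two distinct lines, and
      these are images under \<open>phi\<close>.\<close>
    obtain r where r: "r \<in> P'" "r \<notin> m" using image_point_off_line[OF m(3)] .
    have "q \<noteq> r" using m r by auto
    then obtain n where n: "n \<in> L'" "q \<in> n" "r \<in> n" using B.join_ex[OF q r(1)] by metis
    obtain a where a: "a \<in> L" "m = phi a" using phi_surj[OF m(3)] .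
    obtain b where b: "b \<in> L" "n = phi b" using phi_surj[OF n(1)] .
    have "a \<noteq> b" using a b n r by auto
    then show "q \<in> lam ` P"
      using meeting_images_meet[OF False dims a(1) b(1)] m n a b by simp
  qed
qed

end

section \<open>Coordinates\<close>

locale left_space =
  fixes F :: "'f ring" and V :: "('f, 'v) module"
  assumes left_vector_space: "left_vector_space F V"
begin

sublocale F: ring F
  using left_vector_space unfolding left_vector_space_def skew_field_def by simp

sublocale V: abelian_group V
  using left_vector_space unfolding left_vector_space_def by simp

lemma module_axioms: "module_axioms F V"
  using left_vector_space unfolding left_vector_space_def by simp

lemma smult_closed [simp]: "a \<in> carrier F \<Longrightarrow> x \<in> carrier V \<Longrightarrow> a \<odot>\<^bsub>V\<^esub> x \<in> carrier V"
  and smult_l_distr: "a \<in> carrier F \<Longrightarrow> b \<in> carrier F \<Longrightarrow> x \<in> carrier V \<Longrightarrow>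
    (a \<oplus>\<^bsub>F\<^esub> b) \<odot>\<^bsub>V\<^esub> x = a \<odot>\<^bsub>V\<^esub> x \<oplus>\<^bsub>V\<^esub> b \<odot>\<^bsub>V\<^esub> x"
  and smult_r_distr: "a \<in> carrier F \<Longrightarrow> x \<in> carrier V \<Longrightarrow> y \<in> carrier V \<Longrightarrow>
    a \<odot>\<^bsub>V\<^esub> (x \<oplus>\<^bsub>V\<^esub> y) = a \<odot>\<^bsub>V\<^esub> x \<oplus>\<^bsub>V\<^esub> a \<odot>\<^bsub>V\<^esub> y"
  and smult_assoc: "a \<in> carrier F \<Longrightarrow> b \<in> carrier F \<Longrightarrow> x \<in> carrier V \<Longrightarrow>
    (a \<otimes>\<^bsub>F\<^esub> b) \<odot>\<^bsub>V\<^esub> x = a \<odot>\<^bsub>V\<^esub> (b \<odot>\<^bsub>V\<^esub> x)"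
  and smult_one [simp]: "x \<in> carrier V \<Longrightarrow> \<one>\<^bsub>F\<^esub> \<odot>\<^bsub>V\<^esub> x = x"
  using module_axioms unfolding module_axioms_def by simp_all

lemma smult_l_zero [simp]:
  assumes "x \<in> carrier V" shows "\<zero>\<^bsub>F\<^esub> \<odot>\<^bsub>V\<^esub> x = \<zero>\<^bsub>V\<^esub>"
proof -
  have "\<zero>\<^bsub>F\<^esub> \<odot>\<^bsub>V\<^esub> x \<oplus>\<^bsub>V\<^esub> \<zero>\<^bsub>F\<^esub> \<odot>\<^bsub>V\<^esub> x = \<zero>\<^bsub>F\<^esub> \<odot>\<^bsub>V\<^esub> x"
    using smult_l_distr[of "\<zero>\<^bsub>F\<^esub>" "\<zero>\<^bsub>F\<^esub>" x] assms by simp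
  then show ?thesis using V.add.r_cancel_one assms by simp
qed

lemma smult_r_zero [simp]:
  assumes "a \<in> carrier F" shows "a \<odot>\<^bsub>V\<^esub> \<zero>\<^bsub>V\<^esub> = \<zero>\<^bsub>V\<^esub>"
proof -
  have "a \<odot>\<^bsub>V\<^esub> \<zero>\<^bsub>V\<^esub> \<oplus>\<^bsub>V\<^esub> a \<odot>\<^bsub>V\<^esub> \<zero>\<^bsub>V\<^esub> = a \<odot>\<^bsub>V\<^esub> \<zero>\<^bsub>V\<^esub>"
    using smult_r_distr[of a "\<zero>\<^bsub>V\<^esub>" "\<zero>\<^bsub>V\<^esub>"] assms by simp
  then show ?thesis using V.add.r_cancel_one assms by simp
qed

lemma smult_l_minus:
  assumes "a \<in> carrier F" "x \<in> carrier V"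
  shows "(\<ominus>\<^bsub>F\<^esub> a) \<odot>\<^bsub>V\<^esub> x = \<ominus>\<^bsub>V\<^esub> (a \<odot>\<^bsub>V\<^esub> x)"
proof -
  have "(\<ominus>\<^bsub>F\<^esub> a) \<odot>\<^bsub>V\<^esub> x \<oplus>\<^bsub>V\<^esub> a \<odot>\<^bsub>V\<^esub> x = \<zero>\<^bsub>V\<^esub>"
    using smult_l_distr[of "\<ominus>\<^bsub>F\<^esub> a" a x] assms by (simp add: F.l_neg)
  then show ?thesis using V.minus_equality assms by simp
qed

lemma smult_solve:
  assumes "a \<in> carrier F" "a \<noteq> \<zero>\<^bsub>F\<^esub>" "x \<in> carrier V" "a \<odot>\<^bsub>V\<^esub> x = y"
  obtains b where "b \<in> carrier F" "x = b \<odot>\<^bsub>V\<^esub> y"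
proof -
  have "a \<in> Units F"
    using assms left_vector_space unfolding left_vector_space_def skew_field_def by simp
  then obtain b where b: "b \<in> carrier F" "b \<otimes>\<^bsub>F\<^esub> a = \<one>\<^bsub>F\<^esub>" unfolding Units_def by auto
  have "x = b \<odot>\<^bsub>V\<^esub> y" using smult_assoc[OF b(1) assms(1,3)] b assms by simp
  then show ?thesis using that b by simp
qed

lemma add_add_minus:
  assumes "p \<in> carrier V" "q \<in> carrier V" "u \<in> carrier V"
  shows "(p \<oplus>\<^bsub>V\<^esub> q) \<oplus>\<^bsub>V\<^esub> (u \<oplus>\<^bsub>V\<^esub> \<ominus>\<^bsub>V\<^esub> p) = q \<oplus>\<^bsub>V\<^esub> u"
proof -
  have "(p \<oplus>\<^bsub>V\<^esub> q) \<oplus>\<^bsub>V\<^esub> (u \<oplus>\<^bsub>V\<^esub> \<ominus>\<^bsub>V\<^esub> p) = (q \<oplus>\<^bsub>V\<^esub> u) \<oplus>\<^bsub>V\<^esub> (p \<oplus>\<^bsub>V\<^esub> \<ominus>\<^bsub>V\<^esub> p)"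
    using assms by (simp add: V.a_ac del: V.r_neg)
  then show ?thesis using assms by (simp add: V.r_neg)
qed

text \<open>Subtraction gives \<open>(r - s) x = (s' - r') y\<close>, and inverting a nonzero
  \<open>r - s\<close> from the left would make \<open>x\<close> a multiple of \<open>y\<close>. The
  condition is one-sided and allows \<open>y\<close> to be zero, which \<open>smult_cancel\<close>
  exploits.\<close>

lemma smult_coeffs_eq:
  assumes c: "r \<in> carrier F" "r' \<in> carrier F" "s \<in> carrier F" "s' \<in> carrier F"
    and x: "x \<in> carrier V" "y \<in> carrier V"
    and eq: "r \<odot>\<^bsub>V\<^esub> x \<oplus>\<^bsub>V\<^esub> r' \<odot>\<^bsub>V\<^esub> y = s \<odot>\<^bsub>V\<^esub> x \<oplus>\<^bsub>V\<^esub> s' \<odot>\<^bsub>V\<^esub> y"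
    and indep: "\<And>t. t \<in> carrier F \<Longrightarrow> x \<noteq> t \<odot>\<^bsub>V\<^esub> y"
  shows "r = s"
proof (rule ccontr)
  assume "r \<noteq> s"
  then have ne: "r \<ominus>\<^bsub>F\<^esub> s \<noteq> \<zero>\<^bsub>F\<^esub>" using F.minus_equality[of r "\<ominus>\<^bsub>F\<^esub> s"] c by (auto simp: F.minus_eq)
  have "(r \<ominus>\<^bsub>F\<^esub> s) \<odot>\<^bsub>V\<^esub> x = r \<odot>\<^bsub>V\<^esub> x \<oplus>\<^bsub>V\<^esub> \<ominus>\<^bsub>V\<^esub> (s \<odot>\<^bsub>V\<^esub> x)"
    using c x by (simp add: F.minus_eq smult_l_distr smult_l_minus)
  also have "\<dots> = (r \<odot>\<^bsub>V\<^esub> x \<oplus>\<^bsub>V\<^esub> r' \<odot>\<^bsub>V\<^esub> y) \<oplus>\<^bsub>V\<^esub> (\<ominus>\<^bsub>V\<^esub> (r' \<odot>\<^bsub>V\<^esub> y) \<oplus>\<^bsub>V\<^esub> \<ominus>\<^bsub>V\<^esub> (s \<odot>\<^bsub>V\<^esub> x))"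
    using c x by (simp add: V.a_ac V.r_neg1 V.r_neg2)
  also have "\<dots> = s' \<odot>\<^bsub>V\<^esub> y \<oplus>\<^bsub>V\<^esub> \<ominus>\<^bsub>V\<^esub> (r' \<odot>\<^bsub>V\<^esub> y)"
    unfolding eq using c x by (simp add: add_add_minus)
  also have "\<dots> = (s' \<ominus>\<^bsub>F\<^esub> r') \<odot>\<^bsub>V\<^esub> y"
    using c x by (simp add: F.minus_eq smult_l_distr smult_l_minus)
  finally obtain b where "b \<in> carrier F" "x = b \<odot>\<^bsub>V\<^esub> ((s' \<ominus>\<^bsub>F\<^esub> r') \<odot>\<^bsub>V\<^esub> y)"
    using smult_solve[OF _ ne x(1)] c by auto
  then show False
    using indep[of "b \<otimes>\<^bsub>F\<^esub> (s' \<ominus>\<^bsub>F\<^esub> r')"] c x by (simp add: smult_assoc)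
qed

lemma smult_cancel:
  assumes "s \<in> carrier F" "t \<in> carrier F" "x \<in> carrier V" "x \<noteq> \<zero>\<^bsub>V\<^esub>" "s \<odot>\<^bsub>V\<^esub> x = t \<odot>\<^bsub>V\<^esub> x"
  shows "s = t"
  using smult_coeffs_eq[of s "\<zero>\<^bsub>F\<^esub>" t "\<zero>\<^bsub>F\<^esub>" x "\<zero>\<^bsub>V\<^esub>"] assms by simp

end

locale coordinatized_space = aff_space P L par + left_space F V
  for P :: "'p set" and L :: "'p set set" and par :: "'p set \<Rightarrow> 'p set \<Rightarrow> bool"
    and F :: "'f ring" and V :: "('f, 'p) module" +
  assumes carrier_V: "carrier V = P"
    and lines: "L = {affine_line F V a d | a d. a \<in> P \<and> d \<in> P \<and> d \<noteq> \<zero>\<^bsub>V\<^esub>}"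
    and parallels: "\<And>l m. par l m \<longleftrightarrow>
      (\<exists>a\<in>P. \<exists>b\<in>P. \<exists>d\<in>P. d \<noteq> \<zero>\<^bsub>V\<^esub> \<and> l = affine_line F V a d \<and> m = affine_line F V b d)"
begin

abbreviation add (infixl "\<^bold>+" 65) where "x \<^bold>+ y \<equiv> x \<oplus>\<^bsub>V\<^esub> y"
abbreviation smult (infixr "\<^bold>*" 70) where "t \<^bold>* x \<equiv> t \<odot>\<^bsub>V\<^esub> x"

lemma closed [simp]:
  "\<zero>\<^bsub>V\<^esub> \<in> P" "x \<in> P \<Longrightarrow> y \<in> P \<Longrightarrow> x \<^bold>+ y \<in> P"
  "x \<in> P \<Longrightarrow> y \<in> P \<Longrightarrow> x \<ominus>\<^bsub>V\<^esub> y \<in> P" "t \<in> carrier F \<Longrightarrow> x \<in> P \<Longrightarrow> t \<^bold>* x \<in> P"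
  using V.zero_closed V.a_closed V.minus_closed smult_closed unfolding carrier_V by blast+

lemma line_in: "a \<in> P \<Longrightarrow> d \<in> P \<Longrightarrow> d \<noteq> \<zero>\<^bsub>V\<^esub> \<Longrightarrow> affine_line F V a d \<in> L"
  unfolding lines by auto

lemma line_par:
  "a \<in> P \<Longrightarrow> b \<in> P \<Longrightarrow> d \<in> P \<Longrightarrow> d \<noteq> \<zero>\<^bsub>V\<^esub> \<Longrightarrow> par (affine_line F V a d) (affine_line F V b d)"
  unfolding parallels by auto

lemma line_mem: "t \<in> carrier F \<Longrightarrow> a \<^bold>+ t \<^bold>* d \<in> affine_line F V a d"
  unfolding affine_line_def by auto

lemma line_base:
  assumes "a \<in> P" "d \<in> P" shows "a \<in> affine_line F V a d" "a \<^bold>+ d \<in> affine_line F V a d"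
  using line_mem[of "\<zero>\<^bsub>F\<^esub>" a d] line_mem[of "\<one>\<^bsub>F\<^esub>" a d] assms carrier_V by simp_all

lemma add_cancel:
  assumes "x \<in> P" "y \<in> P" "z \<in> P" "x \<^bold>+ y = x \<^bold>+ z" shows "y = z"
  using V.r_neg1[of x y] V.r_neg1[of x z] assms unfolding carrier_V by metis

lemma add_ne: "a \<in> P \<Longrightarrow> d \<in> P \<Longrightarrow> d \<noteq> \<zero>\<^bsub>V\<^esub> \<Longrightarrow> a \<noteq> a \<^bold>+ d"
  using V.add.l_cancel_one'[of a d] carrier_V by simp

lemma line_eq:
  assumes "l \<in> L" "a \<in> l" "a \<^bold>+ d \<in> l" "a \<in> P" "d \<in> P" "d \<noteq> \<zero>\<^bsub>V\<^esub>"
  shows "l = affine_line F V a d"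
  using join_unique[OF add_ne[OF assms(4-6)] assms(1-3) line_in[OF assms(4-6)] line_base[OF assms(4,5)]] .

lemma line_coeff:
  assumes "l \<in> L" "a \<in> l" "a \<^bold>+ d \<in> l" "a \<^bold>+ e \<in> l" "a \<in> P" "d \<in> P" "e \<in> P" "d \<noteq> \<zero>\<^bsub>V\<^esub>"
  obtains c where "c \<in> carrier F" "e = c \<^bold>* d"
proof -
  have "a \<^bold>+ e \<in> affine_line F V a d" using line_eq[OF assms(1-3,5,6,8)] assms(4) by simp
  then obtain c where c: "c \<in> carrier F" "a \<^bold>+ e = a \<^bold>+ c \<^bold>* d" unfolding affine_line_def by auto
  then have "e = c \<^bold>* d" using add_cancel assms closed(4) by metis
  then show ?thesis using that c by simp
qed

text \<open>Moving the base point of \<open>l\<close> to \<open>b\<close> gives a line with the same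
  direction \<open>d\<close>, which is \<open>m\<close> by uniqueness of parallels.\<close>

lemma par_coeff:
  assumes "par m l" "a \<in> l" "a \<^bold>+ d \<in> l" "b \<in> m" "b \<^bold>+ e \<in> m" "a \<in> P" "d \<in> P" "d \<noteq> \<zero>\<^bsub>V\<^esub>"
    "b \<in> P" "e \<in> P"
  obtains c where "c \<in> carrier F" "e = c \<^bold>* d"
proof -
  have L: "m \<in> L" "l \<in> L" using par_line[OF assms(1)] .
  have "l = affine_line F V a d" using line_eq[OF L(2) assms(2,3,6,7,8)] .
  then have "par m (affine_line F V b d)"
    using par_trans[OF assms(1)] line_par[OF assms(6,9,7,8)] by simp
  then have "m = affine_line F V b d"
    using parallel_unique[OF _ assms(4) line_base(1)[OF assms(9,7)]] by simp
  then have "b \<^bold>+ d \<in> m" using line_base(2)[OF assms(9,7)] by simp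
  then show ?thesis using line_coeff[OF L(1) assms(4) _ assms(5,9,7,10,8)] that by metis
qed

lemma add_diff [simp]: "a \<in> P \<Longrightarrow> b \<in> P \<Longrightarrow> a \<^bold>+ (b \<ominus>\<^bsub>V\<^esub> a) = b"
  using V.r_neg2[of a b] V.a_comm[of b "\<ominus>\<^bsub>V\<^esub> a"] V.a_inv_closed[of a] carrier_V by (simp add: V.minus_eq)

lemma diff_eq_zero: "a \<in> P \<Longrightarrow> b \<in> P \<Longrightarrow> b \<ominus>\<^bsub>V\<^esub> a = \<zero>\<^bsub>V\<^esub> \<Longrightarrow> b = a"
  using add_diff[of a b] carrier_V by simp

lemma add_assoc: "x \<in> P \<Longrightarrow> y \<in> P \<Longrightarrow> z \<in> P \<Longrightarrow> (x \<^bold>+ y) \<^bold>+ z = x \<^bold>+ (y \<^bold>+ z)"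
  using V.a_assoc carrier_V by simp

lemma add_comm: "x \<in> P \<Longrightarrow> y \<in> P \<Longrightarrow> x \<^bold>+ y = y \<^bold>+ x"
  using V.a_comm carrier_V by simp

end

locale coordinatized_line_bijection =
  line_bijection P L par P' L' par' phi lam +
  A: coordinatized_space P L par F V + B: coordinatized_space P' L' par' F' V'
  for P :: "'p set" and L :: "'p set set" and par :: "'p set \<Rightarrow> 'p set \<Rightarrow> bool"
    and P' :: "'q set" and L' :: "'q set set" and par' :: "'q set \<Rightarrow> 'q set \<Rightarrow> bool"
    and phi :: "'p set \<Rightarrow> 'q set" and lam :: "'p \<Rightarrow> 'q"
    and F :: "'f ring" and V :: "('f, 'p) module" and F' :: "'g ring" and V' :: "('g, 'q) module" +
  assumes ord: "\<not> has_order L 2"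
begin

notation A.add (infixl "+\<^sub>A" 65) and A.smult (infixr "*\<^sub>A" 70)
  and B.add (infixl "+\<^sub>B" 65) and B.smult (infixr "*\<^sub>B" 70)

section \<open>Displacements of image points and their independence of the base point\<close>

definition D :: "'p \<Rightarrow> 'p \<Rightarrow> 'q" where
  "D a d = lam (a +\<^sub>A d) \<ominus>\<^bsub>V'\<^esub> lam a"

lemma D_closed: "a \<in> P \<Longrightarrow> d \<in> P \<Longrightarrow> D a d \<in> P'"
  unfolding D_def by (simp add: lam_point)

lemma lam_add: "a \<in> P \<Longrightarrow> d \<in> P \<Longrightarrow> lam (a +\<^sub>A d) = lam a +\<^sub>B D a d"
  unfolding D_def using B.add_diff lam_point by simp

lemma D_nonzero:
  assumes "a \<in> P" "d \<in> P" "d \<noteq> \<zero>\<^bsub>V\<^esub>" shows "D a d \<noteq> \<zero>\<^bsub>V'\<^esub>"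
proof
  assume "D a d = \<zero>\<^bsub>V'\<^esub>"
  then have "lam (a +\<^sub>A d) = lam a"
    unfolding D_def using B.diff_eq_zero lam_point assms by simp
  then show False using lam_inj[of "a +\<^sub>A d" a] A.add_ne[OF assms] assms by simp
qed

lemma D_on_line:
  assumes "l \<in> L" "a \<in> l" "a +\<^sub>A d \<in> l" "a \<in> P" "d \<in> P"
  shows "lam a \<in> phi l" "lam a +\<^sub>B D a d \<in> phi l"
  using lam_in[OF assms(1,2)] lam_in[OF assms(1,3)] lam_add[OF assms(4,5)] by simp_all

text \<open>A dependence would put \<open>lam\<close> of the point \<open>a + d\<close> on the image
  of the line through \<open>a\<close> in direction \<open>e\<close>, against
  \<open>lam_line\<close>.\<close>

lemma D_independent:
  assumes P: "a \<in> P" "d \<in> P" "d \<noteq> \<zero>\<^bsub>V\<^esub>" "e \<in> P" "e \<noteq> \<zero>\<^bsub>V\<^esub>"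
    and off: "a +\<^sub>A d \<notin> affine_line F V a e" and t: "t \<in> carrier F'"
  shows "D a d \<noteq> t *\<^sub>B D a e"
proof
  assume eq: "D a d = t *\<^sub>B D a e"
  let ?l = "affine_line F V a e"
  have l: "?l \<in> L" "a \<in> ?l" "a +\<^sub>A e \<in> ?l" using A.line_in A.line_base P by auto
  have "phi ?l = affine_line F' V' (lam a) (D a e)"
    using B.line_eq[OF phi_line[OF l(1)] D_on_line[OF l P(1,4)] lam_point[OF P(1)]
        D_closed[OF P(1,4)] D_nonzero[OF P(1,4,5)]] .
  then have "lam a +\<^sub>B D a d \<in> phi ?l" using B.line_mem[OF t] eq by simp
  then have "lam (a +\<^sub>A d) \<in> phi ?l" using lam_add P by simp
  then show False using off lam_line[of "a +\<^sub>A d"] l(1) P by simp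
qed

lemma D_parallel:
  assumes "a \<in> P" "b \<in> P" "d \<in> P" "d \<noteq> \<zero>\<^bsub>V\<^esub>"
  obtains c where "c \<in> carrier F'" "D b d = c *\<^sub>B D a d"
proof -
  let ?l = "affine_line F V a d" and ?m = "affine_line F V b d"
  have l: "?l \<in> L" "a \<in> ?l" "a +\<^sub>A d \<in> ?l" and m: "?m \<in> L" "b \<in> ?m" "b +\<^sub>A d \<in> ?m"
    using A.line_in A.line_base assms by auto
  have "par' (phi ?m) (phi ?l)" using phi_parallel[OF ord A.line_par[OF assms(2,1,3,4)]] .
  then show ?thesis
    using B.par_coeff[OF _ D_on_line[OF l assms(1,3)] D_on_line[OF m assms(2,3)]
        lam_point[OF assms(1)] D_closed[OF assms(1,3)] D_nonzero[OF assms(1,3,4)]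
        lam_point[OF assms(2)] D_closed[OF assms(2,3)]] that by metis
qed

text \<open>Walk around the parallelogram \<open>a\<close>, \<open>a + d\<close>, \<open>b\<close>,
  \<open>b + d\<close> both ways. Opposite sides have proportional displacements, with factors
  \<open>c\<close> and \<open>c'\<close>; comparing coefficients of the independent
  \<open>D a d\<close> and \<open>D a e\<close> gives \<open>c = 1\<close>.\<close>

lemma D_eq_off_line:
  assumes P: "a \<in> P" "b \<in> P" "d \<in> P" "d \<noteq> \<zero>\<^bsub>V\<^esub>" and off: "b \<notin> affine_line F V a d"
  shows "D b d = D a d"
proof -
  define e where "e = b \<ominus>\<^bsub>V\<^esub> a"
  have e: "e \<in> P" "a +\<^sub>A e = b" unfolding e_def using P by simp_all
  have "b \<noteq> a" using off A.line_base(1)[OF P(1,3)] by auto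
  then have e0: "e \<noteq> \<zero>\<^bsub>V\<^esub>" unfolding e_def using A.diff_eq_zero[OF P(1,2)] by auto
  have dl: "a +\<^sub>A d \<notin> affine_line F V a e"
  proof
    assume "a +\<^sub>A d \<in> affine_line F V a e"
    then have "affine_line F V a e = affine_line F V a d"
      using A.line_eq[OF A.line_in[OF P(1) e(1) e0] A.line_base(1)[OF P(1) e(1)] _ P(1,3,4)] by simp
    then show False using off A.line_base(2)[OF P(1) e(1)] e(2) by simp
  qed
  obtain c where c: "c \<in> carrier F'" "D b d = c *\<^sub>B D a d" using D_parallel[OF P] .
  obtain c' where c': "c' \<in> carrier F'" "D (a +\<^sub>A d) e = c' *\<^sub>B D a e"
    using D_parallel[OF P(1) _ e(1) e0, of "a +\<^sub>A d"] P by auto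
  have X: "D a d \<in> P'" "D a e \<in> P'" using D_closed P e by auto
  have cl: "c *\<^sub>B D a d \<in> P'" "c' *\<^sub>B D a e \<in> P'" using c c' X by auto
  have "lam ((a +\<^sub>A d) +\<^sub>A e) = lam a +\<^sub>B (D a d +\<^sub>B c' *\<^sub>B D a e)"
    using lam_add[of "a +\<^sub>A d" e] lam_add[of a d] P e c' X cl B.add_assoc lam_point by simp
  moreover have "lam (b +\<^sub>A d) = lam a +\<^sub>B (D a e +\<^sub>B c *\<^sub>B D a d)"
    using lam_add[of b d] lam_add[of a e] P e c X cl B.add_assoc lam_point by simp
  moreover have "(a +\<^sub>A d) +\<^sub>A e = b +\<^sub>A d"
    using A.add_assoc A.add_comm P e by metis
  ultimately have "D a d +\<^sub>B c' *\<^sub>B D a e = D a e +\<^sub>B c *\<^sub>B D a d"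
    using B.add_cancel[OF lam_point[OF P(1)]] X cl by simp
  then have "\<one>\<^bsub>F'\<^esub> *\<^sub>B D a d +\<^sub>B c' *\<^sub>B D a e = c *\<^sub>B D a d +\<^sub>B \<one>\<^bsub>F'\<^esub> *\<^sub>B D a e"
    using B.add_comm X cl B.carrier_V by simp
  then have "c = \<one>\<^bsub>F'\<^esub>"
    using B.smult_coeffs_eq[of "\<one>\<^bsub>F'\<^esub>" c' c "\<one>\<^bsub>F'\<^esub>" "D a d" "D a e"] c c' X B.carrier_V
      D_independent[OF P(1,3,4) e(1) e0 dl] by simp
  then show ?thesis using c X B.carrier_V by simp
qed

lemma D_eq:
  assumes P: "a \<in> P" "b \<in> P" "d \<in> P" "d \<noteq> \<zero>\<^bsub>V\<^esub>"
  shows "D b d = D a d"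
proof (cases "b \<in> affine_line F V a d")
  case False
  then show ?thesis using D_eq_off_line[OF P] by simp
next
  case True
  let ?l = "affine_line F V a d"
  have l: "?l \<in> L" using A.line_in P by simp
  \<comment> \<open>Two off-line comparisons, through a detour point \<open>r\<close>, cover base
    points on the same line.\<close>
  obtain r where r: "r \<in> P" "r \<notin> ?l" using point_off_line[OF l] .
  have "b \<notin> affine_line F V r d"
  proof
    assume "b \<in> affine_line F V r d"
    then have "affine_line F V r d = ?l"
      using A.parallel_unique[OF A.line_par[OF r(1) P(1,3,4)] _ True] by simp
    then show False using r A.line_base(1)[OF r(1) P(3)] by simp
  qed
  then show ?thesis using D_eq_off_line[OF P(1) r(1) P(3,4) r(2)] D_eq_off_line[OF r(1) P(2-4)] by simp
qed

section \<open>The additive part of \<open>lam\<close> and its companion homomorphism\<close>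

definition mu :: "'p \<Rightarrow> 'q" where "mu v = D \<zero>\<^bsub>V\<^esub> v"

lemma mu_closed: "v \<in> P \<Longrightarrow> mu v \<in> P'"
  unfolding mu_def using D_closed by simp

lemma mu_zero: "mu \<zero>\<^bsub>V\<^esub> = \<zero>\<^bsub>V'\<^esub>"
  using lam_add[of "\<zero>\<^bsub>V\<^esub>" "\<zero>\<^bsub>V\<^esub>"] mu_closed[of "\<zero>\<^bsub>V\<^esub>"] lam_point[of "\<zero>\<^bsub>V\<^esub>"]
    B.V.add.l_cancel_one'[of "lam \<zero>\<^bsub>V\<^esub>" "mu \<zero>\<^bsub>V\<^esub>"] A.carrier_V B.carrier_V
  unfolding mu_def by simp

lemma lam_mu:
  assumes "v \<in> P" shows "lam v = lam \<zero>\<^bsub>V\<^esub> +\<^sub>B mu v"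
  using lam_add[of "\<zero>\<^bsub>V\<^esub>" v] assms A.carrier_V unfolding mu_def by simp

lemma mu_add:
  assumes "v \<in> P" "w \<in> P" shows "mu (v +\<^sub>A w) = mu v +\<^sub>B mu w"
proof (cases "w = \<zero>\<^bsub>V\<^esub>")
  case True
  then show ?thesis using mu_zero mu_closed assms A.carrier_V B.carrier_V by simp
next
  case False
  have "lam \<zero>\<^bsub>V\<^esub> +\<^sub>B mu (v +\<^sub>A w) = lam v +\<^sub>B D v w"
    using lam_mu[of "v +\<^sub>A w"] lam_add assms by simp
  also have "\<dots> = lam \<zero>\<^bsub>V\<^esub> +\<^sub>B (mu v +\<^sub>B mu w)"
    using lam_mu[of v] D_eq[of "\<zero>\<^bsub>V\<^esub>" v w] False assms mu_closed lam_point B.add_assoc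
    unfolding mu_def by simp
  finally show ?thesis using B.add_cancel[of "lam \<zero>\<^bsub>V\<^esub>"] assms mu_closed lam_point by simp
qed

lemma mu_inj: "v \<in> P \<Longrightarrow> w \<in> P \<Longrightarrow> mu v = mu w \<Longrightarrow> v = w"
  using lam_mu lam_inj by metis

lemma mu_smult_ex:
  assumes v: "v \<in> P" "v \<noteq> \<zero>\<^bsub>V\<^esub>" and t: "t \<in> carrier F"
  obtains s where "s \<in> carrier F'" "mu (t *\<^sub>A v) = s *\<^sub>B mu v"
proof -
  let ?l = "affine_line F V \<zero>\<^bsub>V\<^esub> v"
  have l: "?l \<in> L" "\<zero>\<^bsub>V\<^esub> \<in> ?l" "\<zero>\<^bsub>V\<^esub> +\<^sub>A v \<in> ?l" "\<zero>\<^bsub>V\<^esub> +\<^sub>A t *\<^sub>A v \<in> ?l"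
    using A.line_in A.line_base v A.line_mem t by auto
  show ?thesis
    using B.line_coeff[OF phi_line[OF l(1)] D_on_line[OF l(1-3)] D_on_line(2)[OF l(1,2,4)]]
      lam_point D_closed D_nonzero v t that unfolding mu_def by auto
qed

text \<open>Expanding the image of \<open>t (v + w)\<close> in two ways gives
  \<open>r mu v + r mu w = s mu v + s' mu w\<close>; the two vectors are independent, so
  \<open>r = s\<close> and \<open>r = s'\<close>.\<close>

lemma mu_smult_uniform_off:
  assumes v: "v \<in> P" "v \<noteq> \<zero>\<^bsub>V\<^esub>" and w: "w \<in> P" "w \<noteq> \<zero>\<^bsub>V\<^esub>"
    and off: "w \<notin> affine_line F V \<zero>\<^bsub>V\<^esub> v" and t: "t \<in> carrier F"
    and s: "s \<in> carrier F'" "mu (t *\<^sub>A v) = s *\<^sub>B mu v"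
  shows "mu (t *\<^sub>A w) = s *\<^sub>B mu w"
proof -
  have off': "v \<notin> affine_line F V \<zero>\<^bsub>V\<^esub> w"
  proof
    assume "v \<in> affine_line F V \<zero>\<^bsub>V\<^esub> w"
    then have "affine_line F V \<zero>\<^bsub>V\<^esub> w = affine_line F V \<zero>\<^bsub>V\<^esub> v"
      using A.line_eq[OF A.line_in[OF _ w] A.line_base(1)[OF _ w(1)], of "\<zero>\<^bsub>V\<^esub>" v] v A.carrier_V by simp
    then show False using off A.line_base(2)[of "\<zero>\<^bsub>V\<^esub>" w] w A.carrier_V by simp
  qed
  have "v +\<^sub>A w \<noteq> \<zero>\<^bsub>V\<^esub>"
  proof
    assume "v +\<^sub>A w = \<zero>\<^bsub>V\<^esub>"
    then have "w = (\<ominus>\<^bsub>F\<^esub> \<one>\<^bsub>F\<^esub>) *\<^sub>A v"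
      using A.smult_l_minus[of "\<one>\<^bsub>F\<^esub>" v] A.V.minus_equality[of w v] A.add_comm v w A.carrier_V by simp
    then show False using off A.line_mem[of "\<ominus>\<^bsub>F\<^esub> \<one>\<^bsub>F\<^esub>" "\<zero>\<^bsub>V\<^esub>" v] w A.carrier_V by simp
  qed
  then obtain r where r: "r \<in> carrier F'" "mu (t *\<^sub>A (v +\<^sub>A w)) = r *\<^sub>B mu (v +\<^sub>A w)"
    using mu_smult_ex[of "v +\<^sub>A w" t] v w t by auto
  obtain s' where s': "s' \<in> carrier F'" "mu (t *\<^sub>A w) = s' *\<^sub>B mu w" using mu_smult_ex[OF w t] .
  have M: "mu v \<in> carrier V'" "mu w \<in> carrier V'" using mu_closed v w B.carrier_V by auto
  have "mu (t *\<^sub>A (v +\<^sub>A w)) = s *\<^sub>B mu v +\<^sub>B s' *\<^sub>B mu w"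
    using A.smult_r_distr[of t v w] mu_add[of "t *\<^sub>A v" "t *\<^sub>A w"] v w t s s' A.carrier_V by simp
  then have eq: "r *\<^sub>B mu v +\<^sub>B r *\<^sub>B mu w = s *\<^sub>B mu v +\<^sub>B s' *\<^sub>B mu w"
    using r mu_add[of v w] v w B.smult_r_distr[OF r(1) M] by simp
  have "mu v \<noteq> u *\<^sub>B mu w" if "u \<in> carrier F'" for u
    unfolding mu_def using D_independent[OF _ v w _ that, of "\<zero>\<^bsub>V\<^esub>"] off' v A.carrier_V by simp
  then have "r = s" using B.smult_coeffs_eq[OF r(1,1) s(1) s'(1) M eq] by simp
  moreover have "mu w \<noteq> u *\<^sub>B mu v" if "u \<in> carrier F'" for u
    unfolding mu_def using D_independent[OF _ w v _ that, of "\<zero>\<^bsub>V\<^esub>"] off w A.carrier_V by simp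
  moreover have "r *\<^sub>B mu w +\<^sub>B r *\<^sub>B mu v = s' *\<^sub>B mu w +\<^sub>B s *\<^sub>B mu v"
    using eq B.V.a_comm M r s s' by simp
  ultimately have "r = s'" using B.smult_coeffs_eq[OF r(1,1) s'(1) s(1) M(2,1)] by simp
  then show ?thesis using \<open>r = s\<close> s' by simp
qed

text \<open>The factor \<open>h\<close> is read off from one vector \<open>v\<close>. Vectors off
  its line are compared with \<open>v\<close>, those on it with an auxiliary \<open>u\<close> off
  the line. The nonzero \<open>v\<close> is returned so that scalars can be cancelled.\<close>

lemma semilinear:
  obtains h v where "\<And>t w. t \<in> carrier F \<Longrightarrow> w \<in> P \<Longrightarrow> h t \<in> carrier F' \<and> mu (t *\<^sub>A w) = h t *\<^sub>B mu w"
    and "v \<in> P" "v \<noteq> \<zero>\<^bsub>V\<^esub>"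
proof -
  obtain k where k: "k \<in> L" using line_exists .
  obtain v where v: "v \<in> k" "v \<noteq> \<zero>\<^bsub>V\<^esub>" using A.line_other_point[OF k] .
  have vP: "v \<in> P" using A.line_subset[OF k] v by auto
  let ?l = "affine_line F V \<zero>\<^bsub>V\<^esub> v"
  have l: "?l \<in> L" "\<zero>\<^bsub>V\<^esub> \<in> ?l" "v \<in> ?l"
    using A.line_in[of "\<zero>\<^bsub>V\<^esub>" v] A.line_base[of "\<zero>\<^bsub>V\<^esub>" v] v vP A.carrier_V by simp_all
  obtain u where u: "u \<in> P" "u \<notin> ?l" using point_off_line[OF l(1)] .
  have u0: "u \<noteq> \<zero>\<^bsub>V\<^esub>" using u l by auto
  have "\<forall>t. \<exists>s. t \<in> carrier F \<longrightarrow> s \<in> carrier F' \<and> mu (t *\<^sub>A v) = s *\<^sub>B mu v"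
    using mu_smult_ex[OF vP v(2)] by blast
  then obtain h where h: "\<And>t. t \<in> carrier F \<Longrightarrow> h t \<in> carrier F' \<and> mu (t *\<^sub>A v) = h t *\<^sub>B mu v"
    by metis
  have hu: "mu (t *\<^sub>A u) = h t *\<^sub>B mu u" if t: "t \<in> carrier F" for t
    using mu_smult_uniform_off[OF vP v(2) u(1) u0 u(2) t] h[OF t] by simp
  have "mu (t *\<^sub>A w) = h t *\<^sub>B mu w" if t: "t \<in> carrier F" and w: "w \<in> P" for t w
  proof (cases "w = \<zero>\<^bsub>V\<^esub>")
    case True
    then show ?thesis using t h[OF t] mu_zero by simp
  next
    case w0: False
    show ?thesis
    proof (cases "w \<in> ?l")
      case False
      then show ?thesis using mu_smult_uniform_off[OF vP v(2) w w0 False t] h[OF t] by simp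
    next
      case True
      have "w \<notin> affine_line F V \<zero>\<^bsub>V\<^esub> u"
      proof
        assume "w \<in> affine_line F V \<zero>\<^bsub>V\<^esub> u"
        then have "affine_line F V \<zero>\<^bsub>V\<^esub> u = ?l"
          using A.join_unique[OF w0 A.line_in[OF _ u(1) u0] _ A.line_base(1)[OF _ u(1)] l(1) True l(2)]
          by simp
        then show False using u A.line_base(2)[of "\<zero>\<^bsub>V\<^esub>" u] A.carrier_V by simp
      qed
      then show ?thesis using mu_smult_uniform_off[OF u(1) u0 w w0 _ t] h[OF t] hu[OF t] by simp
    qed
  qed
  then show ?thesis using that[of h v] h vP v(2) by blast
qed

lemma surj_if_monomorphisms_surj:
  assumes surj: "\<And>h. h \<in> ring_hom F F' \<Longrightarrow> inj_on h (carrier F) \<Longrightarrow> h ` carrier F = carrier F'"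
  shows "P' \<subseteq> lam ` P"
proof
  obtain h v where h: "\<And>t w. t \<in> carrier F \<Longrightarrow> w \<in> P \<Longrightarrow> h t \<in> carrier F' \<and> mu (t *\<^sub>A w) = h t *\<^sub>B mu w"
    and v: "v \<in> P" "v \<noteq> \<zero>\<^bsub>V\<^esub>" using semilinear by blast
  have hc: "h t \<in> carrier F'" if "t \<in> carrier F" for t using h[OF that v(1)] by simp
  have hm: "mu (t *\<^sub>A w) = h t *\<^sub>B mu w" if "t \<in> carrier F" "w \<in> P" for t w using h[OF that] by simp
  have M: "mu v \<in> carrier V'" "mu v \<noteq> \<zero>\<^bsub>V'\<^esub>"
    using mu_closed[OF v(1)] D_nonzero[OF _ v, of "\<zero>\<^bsub>V\<^esub>"] B.carrier_V unfolding mu_def by simp_all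
  \<comment> \<open>Ring identities are tested on the nonzero vector \<open>mu v\<close>, from which
    scalars cancel.\<close>
  have "h \<in> ring_hom F F'"
  proof (rule ring_hom_memI)
    fix x y assume xy: "x \<in> carrier F" "y \<in> carrier F"
    have "h (x \<otimes>\<^bsub>F\<^esub> y) *\<^sub>B mu v = h x *\<^sub>B mu (y *\<^sub>A v)"
      using hm[of "x \<otimes>\<^bsub>F\<^esub> y" v] hm[of x "y *\<^sub>A v"] A.smult_assoc[of x y v] xy v A.carrier_V by simp
    also have "\<dots> = (h x \<otimes>\<^bsub>F'\<^esub> h y) *\<^sub>B mu v"
      using hm[of y v] B.smult_assoc[OF hc hc M(1)] xy v by simp
    finally show "h (x \<otimes>\<^bsub>F\<^esub> y) = h x \<otimes>\<^bsub>F'\<^esub> h y"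
      using B.smult_cancel[OF _ _ M] hc xy by simp
    have "h (x \<oplus>\<^bsub>F\<^esub> y) *\<^sub>B mu v = h x *\<^sub>B mu v +\<^sub>B h y *\<^sub>B mu v"
      using hm[of "x \<oplus>\<^bsub>F\<^esub> y" v] mu_add[of "x *\<^sub>A v" "y *\<^sub>A v"] A.smult_l_distr[of x y v] hm[of x v]
        hm[of y v] xy v A.carrier_V by simp
    also have "\<dots> = (h x \<oplus>\<^bsub>F'\<^esub> h y) *\<^sub>B mu v"
      using B.smult_l_distr[OF hc hc M(1)] xy by simp
    finally show "h (x \<oplus>\<^bsub>F\<^esub> y) = h x \<oplus>\<^bsub>F'\<^esub> h y"
      using B.smult_cancel[OF _ _ M] hc xy by simp
  next
    have "h \<one>\<^bsub>F\<^esub> *\<^sub>B mu v = \<one>\<^bsub>F'\<^esub> *\<^sub>B mu v"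
      using hm[of "\<one>\<^bsub>F\<^esub>" v] v A.carrier_V M by simp
    then show "h \<one>\<^bsub>F\<^esub> = \<one>\<^bsub>F'\<^esub>" using B.smult_cancel[OF _ _ M] hc by simp
  qed (use hc in simp)
  moreover have "inj_on h (carrier F)"
  proof (rule inj_onI)
    fix x y assume xy: "x \<in> carrier F" "y \<in> carrier F" "h x = h y"
    then have "mu (x *\<^sub>A v) = mu (y *\<^sub>A v)" using hm v by simp
    then have "x *\<^sub>A v = y *\<^sub>A v" using mu_inj xy v by simp
    then show "x = y" using A.smult_cancel[of x y v] xy v A.carrier_V by simp
  qed
  ultimately have hs: "h ` carrier F = carrier F'" by (rule surj)
  let ?o = "\<zero>\<^bsub>V\<^esub>"
  have oP: "?o \<in> P" by simp
  fix q assume q: "q \<in> P'"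
  show "q \<in> lam ` P"
  proof (cases "q = lam ?o")
    case False
    \<comment> \<open>The line joining \<open>q\<close> to \<open>lam ?o\<close> is some
      \<open>phi l\<close>, and a second point \<open>w\<close> of \<open>l\<close> gives it
      direction \<open>mu w\<close>. Surjectivity of \<open>h\<close> turns the coefficient of
      \<open>q\<close> into one for a point of \<open>l\<close>.\<close>
    obtain m where m: "m \<in> L'" "q \<in> m" "lam ?o \<in> m" using B.join_ex[OF q lam_point[OF oP] False] .
    obtain l where l: "l \<in> L" "m = phi l" using phi_surj[OF m(1)] .
    have ol: "?o \<in> l" using lam_line[OF oP l(1)] m l by simp
    obtain w where w: "w \<in> l" "w \<noteq> ?o" using A.line_other_point[OF l(1)] .
    have wP: "w \<in> P" using A.line_subset[OF l(1)] w by auto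
    have "?o +\<^sub>A w \<in> l" using w wP A.carrier_V by simp
    then have "lam ?o +\<^sub>B mu w \<in> m"
      using D_on_line(2)[OF l(1) ol _ oP wP] l(2) unfolding mu_def by simp
    then obtain c where c: "c \<in> carrier F'" "q \<ominus>\<^bsub>V'\<^esub> lam ?o = c *\<^sub>B mu w"
      using B.line_coeff[OF m(1,3), of "mu w" "q \<ominus>\<^bsub>V'\<^esub> lam ?o"] m q lam_point[OF oP] mu_closed[OF wP]
        D_nonzero[OF oP wP w(2)] unfolding mu_def by auto
    then obtain t where t: "t \<in> carrier F" "c = h t" using hs by auto
    have "q = lam ?o +\<^sub>B mu (t *\<^sub>A w)"
      using c t hm[OF t(1) wP] B.add_diff[OF lam_point[OF oP] q] by simp
    then have "q = lam (t *\<^sub>A w)" using lam_mu[of "t *\<^sub>A w"] t wP by simp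
    then show ?thesis using t wP by auto
  qed (use oP in auto)
qed

end

section \<open>The four sufficient conditions together\<close>

theorem theorem4:
  fixes P :: "'p set" and L :: "'p set set" and par :: "'p set \<Rightarrow> 'p set \<Rightarrow> bool"
    and P' :: "'q set" and L' :: "'q set set" and par' :: "'q set \<Rightarrow> 'q set \<Rightarrow> bool"
    and phi :: "'p set \<Rightarrow> 'q set" and lam :: "'p \<Rightarrow> 'q"
  assumes A: "affine_space P L par"
    and A': "affine_space P' L' par'"
    and dimA': "affdim P' L' par' \<ge> 3"
    and bij: "bij_betw phi L L'"
    and related: "\<forall>a\<in>L. \<forall>b\<in>L. a \<inter> b \<noteq> {} \<longrightarrow> phi a \<inter> phi b \<noteq> {}"
    and lam: "\<forall>a\<in>L. \<forall>b\<in>L. \<forall>p. a \<noteq> b \<and> a \<inter> b = {p} \<longrightarrow> phi a \<inter> phi b = {lam p}"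
    and cond: "(finite P \<or> finite P')
      \<or> (affdim P L par \<le> affdim P' L' par' \<and> affdim P' L' par' < \<infinity>)
      \<or> (\<not> has_order L 2 \<and>
          (\<exists>(F :: 'f ring) (F' :: 'g ring).
             coordinatizes F P L par \<and> coordinatizes F' P' L' par' \<and>
             (\<forall>h. h \<in> ring_hom F F' \<and> inj_on h (carrier F) \<longrightarrow> h ` carrier F = carrier F')))
      \<or> (has_order L 2 \<and> has_order L' 2)"
  shows "collineation P L P' L' lam"
proof -
  interpret line_bijection P L par P' L' par' phi lam
    using A A' dimA' bij lam
    by (simp add: line_bijection_def line_bijection_axioms_def aff_space_def)
  consider (fin) "finite P \<or> finite P'"
    | (dim) "affdim P L par \<le> affdim P' L' par'" "affdim P' L' par' < \<infinity>"
    | (coord) "\<not> has_order L 2" "\<exists>(F :: 'f ring) (F' :: 'g ring).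
        coordinatizes F P L par \<and> coordinatizes F' P' L' par' \<and>
        (\<forall>h. h \<in> ring_hom F F' \<and> inj_on h (carrier F) \<longrightarrow> h ` carrier F = carrier F')"
    | (two) "has_order L' 2"
    using cond by (elim disjE conjE) simp_all
  then have "P' \<subseteq> lam ` P"
  proof cases
    case fin
    have "inj_on lam P" "lam ` P \<subseteq> P'"
      using lam_inj lam_point by (auto intro: inj_onI)
    \<comment> \<open>\<open>lam\<close> embeds \<open>P\<close> into \<open>P'\<close>, so
      finiteness of either space reduces to that of \<open>P\<close>.\<close>
    then have "finite P"
      using fin inj_on_finite by metis
    then show ?thesis by (rule surj_if_finite)
  next
    case dim
    then show ?thesis by (rule surj_if_affdim_le)
  next
    case coord
    then obtain F :: "'f ring" and F' :: "'g ring"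
      where F: "coordinatizes F P L par" and F': "coordinatizes F' P' L' par'"
        and surj: "\<And>h. h \<in> ring_hom F F' \<Longrightarrow> inj_on h (carrier F) \<Longrightarrow> h ` carrier F = carrier F'"
      by auto
    obtain V :: "('f, 'p) module" where V: "coordinatized_space P L par F V"
      using F A unfolding coordinatizes_def coordinatized_space_def coordinatized_space_axioms_def
        aff_space_def left_space_def by auto
    obtain V' :: "('g, 'q) module" where V': "coordinatized_space P' L' par' F' V'"
      using F' A' unfolding coordinatizes_def coordinatized_space_def coordinatized_space_axioms_def
        aff_space_def left_space_def by auto
    interpret coordinatized_line_bijection P L par P' L' par' phi lam F V F' V'
      using V V' coord(1) line_bijection_axioms
      by (simp add: coordinatized_line_bijection_def coordinatized_line_bijection_axioms_def)
    show ?thesis using surj by (rule surj_if_monomorphisms_surj)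
  next
    case two
    then show ?thesis by (rule surj_if_order_two)
  qed
  then show ?thesis by (rule collineation_if_surj)
qed

end
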